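(* Let $G$ be an $X$-generated group with the property $(\dagger)$, i.e. $G$ admits a presentation $G=\mathrm{Gp}\langle X\mid w_i=1\ (i\in I)\rangle$ in which each relator word $w_i$ is cyclic with respect to $(G,X)$, and let $G=\mathrm{Gp}\langle X\mid w_i=1\ (i\in I)\rangle$ be any of its presentations witnessing this property. Then the inverse monoid $M_{sF}(G,X)$ is presented (as an $X$-generated inverse monoid) by the relations $$u=v^{-1}$$ for all non-empty words $u,v\in\overline X^*$ such that $uv$ is a cyclic conjugate of $w_i$ for some $i\in I$.
   Context: Words: $\overline X=X\cup X^{-1}$ is the doubled alphabet; for $v\in\overline X^*$, $v^{-1}$ is the formal inverse word. A group or inverse monoid $S$ is $X$-generated if it comes with a (not necessarily injective) map $X\to S$ whose image generates it; $[w]$ is the element represented by $w\in\overline X^*$. A word is reduced if it contains no subword $xx^{-1}$ or $x^{-1}x$ ($x\in X$), and cyclically reduced if it is reduced and its first and last letters are not mutually inverse. A word $w'$ is a cyclic conjugate of $w$ if $w'=uv$ and $w=vu$ for some words $u,v$. $\mathrm{Gp}\langle X\mid\cdots\rangle$ denotes the group given by a presentation. An $X$-generated inverse monoid is presented by a set of relations if it is canonically isomorphic (respecting generators) to the quotient of the free inverse monoid on $X$ by the congruence generated by these relations. Cayley graph: $\mathrm{Cay}(G,X)$ has vertex set $G$ and, for each $g\in G$, $x\in\overline X$, an edge labelled $x$ from $g$ to $g[x]$; its inverse is the edge labelled $x^{-1}$ from $g[x]$ to $g$. A subgraph is a set of vertices and edges closed under endpoints and inversion of edges; $G$ acts on subgraphs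 by left multiplication. A path is simple if all its vertices are distinct (the empty path at a vertex is simple); a simple cycle is a path ending at its initial vertex such that the initial vertices of all its edges are distinct. The subgraph spanned by a path consists of its edges, their inverses, and all vertices visited. A cyclically reduced word $w$ is cyclic with respect to $(G,X)$ if $w$ labels a simple cycle in $\mathrm{Cay}(G,X)$. Margolis–Meakin expansion: $M(G,X)$ is the inverse monoid of pairs $(\Gamma,g)$ with $\Gamma$ a finite connected subgraph of $\mathrm{Cay}(G,X)$ containing $1$ and $g$, with $(\Delta,g)(\Xi,h)=(\Delta\cup g\Xi,gh)$ and $(\Delta,g)^{-1}=(g^{-1}\Delta,g^{-1})$; it is $X$-generated via $x\mapsto(\Gamma_x,[x])$, where $\Gamma_x$ is the subgraph spanned by the edge labelled $x$ starting at $1$. Let $\xi_G$ be the congruence of $M(G,X)$ generated by all pairs $((\Pi_1,g),(\Pi_2,g))$ with $g\in G$ and $\Pi_1,\Pi_2$ subgraphs spanned by simple paths from $1$ to $g$, and put $M_{sF}(G,X)=M(G,X)/\xi_G$.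
   Formalization: The formal theorem assumes that no relator word w_i has length 1; with such a relator x the claim fails (e.g. G trivial, X={x}, relator x: no relations u=v^{-1} arise, yet x is idempotent in M_sF(G,X)). *)

theory Defs
  imports "HOL-Algebra.Generated_Groups"
begin

section \<open>Words over the doubled alphabet\<close>

text \<open>The letter \<open>(x, True)\<close> is \<open>x\<close> and \<open>(x, False)\<close> is the formal inverse of \<open>x\<close>.\<close>

type_synonym 'x letter = "'x \<times> bool"
type_synonym 'x word = "'x letter list"

definition letters :: "'x set \<Rightarrow> 'x letter set"
  where "letters X = X \<times> UNIV"

definition words :: "'x set \<Rightarrow> 'x word set"
  where "words X = lists (letters X)"

definition linv :: "'x letter \<Rightarrow> 'x letter"
  where "linv a = (fst a, \<not> snd a)"

definition winv :: "'x word \<Rightarrow> 'x word"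
  where "winv w = rev (map linv w)"

definition reduced :: "'x word \<Rightarrow> bool"
  where "reduced w \<longleftrightarrow> (\<nexists>p a q. w = p @ [a, linv a] @ q)"

definition cyclically_reduced :: "'x word \<Rightarrow> bool"
  where "cyclically_reduced w \<longleftrightarrow> reduced w \<and> (w \<noteq> [] \<longrightarrow> last w \<noteq> linv (hd w))"

definition cyclic_conjugate :: "'x word \<Rightarrow> 'x word \<Rightarrow> bool"
  where "cyclic_conjugate w' w \<longleftrightarrow> (\<exists>u v. w' = u @ v \<and> w = v @ u)"

section \<open>Congruences and quotients of monoids\<close>

text \<open>A monoid congruence on a group or an inverse monoid is automatically compatible with
  inversion, so that \<open>cong_gen\<close> is also the generated congruence of those structures.\<close>

inductive_set cong_gen :: "('a, 'b) monoid_scheme \<Rightarrow> ('a \<times> 'a) set \<Rightarrow> ('a \<times> 'a) set"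
  for M (structure) and R
  where
    base: "(a, b) \<in> R \<Longrightarrow> a \<in> carrier M \<Longrightarrow> b \<in> carrier M \<Longrightarrow> (a, b) \<in> cong_gen M R"
  | refl: "a \<in> carrier M \<Longrightarrow> (a, a) \<in> cong_gen M R"
  | sym: "(a, b) \<in> cong_gen M R \<Longrightarrow> (b, a) \<in> cong_gen M R"
  | trans: "(a, b) \<in> cong_gen M R \<Longrightarrow> (b, c) \<in> cong_gen M R \<Longrightarrow> (a, c) \<in> cong_gen M R"
  | mult: "(a, b) \<in> cong_gen M R \<Longrightarrow> (c, d) \<in> cong_gen M R \<Longrightarrow>
      (a \<otimes> c, b \<otimes> d) \<in> cong_gen M R"

text \<open>For a congruence \<open>\<theta>\<close> all classes in the union below coincide.\<close>

definition quot_monoid :: "('a, 'b) monoid_scheme \<Rightarrow> ('a \<times> 'a) set \<Rightarrow> 'a set monoid"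
  where "quot_monoid M \<theta> =
    \<lparr>carrier = carrier M // \<theta>,
     mult = (\<lambda>A B. \<Union>a\<in>A. \<Union>b\<in>B. \<theta> `` {a \<otimes>\<^bsub>M\<^esub> b}),
     one = \<theta> `` {\<one>\<^bsub>M\<^esub>}\<rparr>"

definition word_monoid :: "'x set \<Rightarrow> 'x word monoid"
  where "word_monoid X = \<lparr>carrier = words X, mult = (@), one = []\<rparr>"

section \<open>Generated groups and group presentations\<close>

definition generated_group :: "'x set \<Rightarrow> ('g, 'b) monoid_scheme \<Rightarrow> ('x \<Rightarrow> 'g) \<Rightarrow> bool"
  where "generated_group X G \<iota> \<longleftrightarrow>
    group G \<and> \<iota> \<in> X \<rightarrow> carrier G \<and> generate G (\<iota> ` X) = carrier G"

definition free_group_cong :: "'x set \<Rightarrow> ('x word \<times> 'x word) set"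
  where "free_group_cong X = cong_gen (word_monoid X) {([a, linv a], []) | a. a \<in> letters X}"

definition free_group :: "'x set \<Rightarrow> 'x word set monoid"
  where "free_group X = quot_monoid (word_monoid X) (free_group_cong X)"

definition Gp_cong :: "'x set \<Rightarrow> 'x word set \<Rightarrow> ('x word set \<times> 'x word set) set"
  where "Gp_cong X R = cong_gen (free_group X)
    {(free_group_cong X `` {r}, \<one>\<^bsub>free_group X\<^esub>) | r. r \<in> R}"

text \<open>\<open>Gp X R\<close> is the group given by the presentation with generators \<open>X\<close> and
  relations \<open>r = 1\<close> for \<open>r \<in> R\<close>.\<close>

definition Gp :: "'x set \<Rightarrow> 'x word set \<Rightarrow> 'x word set set monoid"
  where "Gp X R = quot_monoid (free_group X) (Gp_cong X R)"

definition Gp_class :: "'x set \<Rightarrow> 'x word set \<Rightarrow> 'x word \<Rightarrow> 'x word set set"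
  where "Gp_class X R w = Gp_cong X R `` {free_group_cong X `` {w}}"

definition group_presented_by ::
    "'x set \<Rightarrow> ('g, 'b) monoid_scheme \<Rightarrow> ('x \<Rightarrow> 'g) \<Rightarrow> 'x word set \<Rightarrow> bool"
  where "group_presented_by X G \<iota> R \<longleftrightarrow>
    generated_group X G \<iota> \<and> R \<subseteq> words X \<and>
    (\<exists>\<phi> \<in> iso (Gp X R) G. \<forall>x\<in>X. \<phi> (Gp_class X R [(x, True)]) = \<iota> x)"

section \<open>Generated inverse monoids and their presentations\<close>

definition is_inverse :: "('a, 'b) monoid_scheme \<Rightarrow> 'a \<Rightarrow> 'a \<Rightarrow> bool"
  where "is_inverse S a b \<longleftrightarrow> b \<in> carrier S \<and>
    a \<otimes>\<^bsub>S\<^esub> b \<otimes>\<^bsub>S\<^esub> a = a \<and> b \<otimes>\<^bsub>S\<^esub> a \<otimes>\<^bsub>S\<^esub> b = b"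

definition inverse_monoid :: "('a, 'b) monoid_scheme \<Rightarrow> bool"
  where "inverse_monoid S \<longleftrightarrow> monoid S \<and> (\<forall>a \<in> carrier S. \<exists>!b. is_inverse S a b)"

inductive_set inv_submonoid_gen :: "('a, 'b) monoid_scheme \<Rightarrow> 'a set \<Rightarrow> 'a set"
  for S (structure) and A
  where
    one: "\<one> \<in> inv_submonoid_gen S A"
  | incl: "a \<in> A \<Longrightarrow> a \<in> inv_submonoid_gen S A"
  | inverse: "a \<in> inv_submonoid_gen S A \<Longrightarrow> is_inverse S a b \<Longrightarrow> b \<in> inv_submonoid_gen S A"
  | mult: "a \<in> inv_submonoid_gen S A \<Longrightarrow> b \<in> inv_submonoid_gen S A \<Longrightarrow>
      a \<otimes> b \<in> inv_submonoid_gen S A"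

definition generated_inverse_monoid :: "'x set \<Rightarrow> ('a, 'b) monoid_scheme \<Rightarrow> ('x \<Rightarrow> 'a) \<Rightarrow> bool"
  where "generated_inverse_monoid X S \<iota> \<longleftrightarrow>
    inverse_monoid S \<and> \<iota> \<in> X \<rightarrow> carrier S \<and> inv_submonoid_gen S (\<iota> ` X) = carrier S"

text \<open>The free inverse monoid is the quotient of the words by the Wagner congruence.\<close>

definition wagner_cong :: "'x set \<Rightarrow> ('x word \<times> 'x word) set"
  where "wagner_cong X = cong_gen (word_monoid X)
    ({(u @ winv u @ u, u) | u. u \<in> words X} \<union>
     {(u @ winv u @ v @ winv v, v @ winv v @ u @ winv u) | u v. u \<in> words X \<and> v \<in> words X})"

definition free_inverse_monoid :: "'x set \<Rightarrow> 'x word set monoid"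
  where "free_inverse_monoid X = quot_monoid (word_monoid X) (wagner_cong X)"

definition Inv_cong ::
    "'x set \<Rightarrow> ('x word \<times> 'x word) set \<Rightarrow> ('x word set \<times> 'x word set) set"
  where "Inv_cong X R = cong_gen (free_inverse_monoid X)
    {(wagner_cong X `` {u}, wagner_cong X `` {v}) | u v. (u, v) \<in> R}"

definition Inv :: "'x set \<Rightarrow> ('x word \<times> 'x word) set \<Rightarrow> 'x word set set monoid"
  where "Inv X R = quot_monoid (free_inverse_monoid X) (Inv_cong X R)"

definition Inv_class ::
    "'x set \<Rightarrow> ('x word \<times> 'x word) set \<Rightarrow> 'x word \<Rightarrow> 'x word set set"
  where "Inv_class X R w = Inv_cong X R `` {wagner_cong X `` {w}}"

definition inverse_monoid_presented_by ::
    "'x set \<Rightarrow> ('a, 'b) monoid_scheme \<Rightarrow> ('x \<Rightarrow> 'a) \<Rightarrow> ('x word \<times> 'x word) set \<Rightarrow> bool"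
  where "inverse_monoid_presented_by X S \<iota> R \<longleftrightarrow>
    generated_inverse_monoid X S \<iota> \<and> R \<subseteq> words X \<times> words X \<and>
    (\<exists>\<phi> \<in> iso (Inv X R) S. \<forall>x\<in>X. \<phi> (Inv_class X R [(x, True)]) = \<iota> x)"

section \<open>The Cayley graph and its subgraphs\<close>

text \<open>The edge \<open>(g, a)\<close> starts at \<open>g\<close> and has label \<open>a\<close>.\<close>

type_synonym ('g, 'x) edge = "'g \<times> 'x letter"

definition letter_val :: "('g, 'b) monoid_scheme \<Rightarrow> ('x \<Rightarrow> 'g) \<Rightarrow> 'x letter \<Rightarrow> 'g"
  where "letter_val G \<iota> a = (if snd a then \<iota> (fst a) else inv\<^bsub>G\<^esub> (\<iota> (fst a)))"

definition tgt :: "('g, 'b) monoid_scheme \<Rightarrow> ('x \<Rightarrow> 'g) \<Rightarrow> ('g, 'x) edge \<Rightarrow> 'g"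
  where "tgt G \<iota> e = fst e \<otimes>\<^bsub>G\<^esub> letter_val G \<iota> (snd e)"

definition einv :: "('g, 'b) monoid_scheme \<Rightarrow> ('x \<Rightarrow> 'g) \<Rightarrow> ('g, 'x) edge \<Rightarrow> ('g, 'x) edge"
  where "einv G \<iota> e = (tgt G \<iota> e, linv (snd e))"

definition cay_edges :: "'x set \<Rightarrow> ('g, 'b) monoid_scheme \<Rightarrow> ('g, 'x) edge set"
  where "cay_edges X G = carrier G \<times> letters X"

fun path :: "'x set \<Rightarrow> ('g, 'b) monoid_scheme \<Rightarrow> ('x \<Rightarrow> 'g) \<Rightarrow>
    'g \<Rightarrow> ('g, 'x) edge list \<Rightarrow> 'g \<Rightarrow> bool"
  where
    "path X G \<iota> g [] h \<longleftrightarrow> g \<in> carrier G \<and> g = h"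
  | "path X G \<iota> g (e # p) h \<longleftrightarrow> e \<in> cay_edges X G \<and> fst e = g \<and> path X G \<iota> (tgt G \<iota> e) p h"

definition simple_path :: "'x set \<Rightarrow> ('g, 'b) monoid_scheme \<Rightarrow> ('x \<Rightarrow> 'g) \<Rightarrow>
    'g \<Rightarrow> ('g, 'x) edge list \<Rightarrow> 'g \<Rightarrow> bool"
  where "simple_path X G \<iota> g p h \<longleftrightarrow> path X G \<iota> g p h \<and> distinct (g # map (tgt G \<iota>) p)"

definition simple_cycle :: "'x set \<Rightarrow> ('g, 'b) monoid_scheme \<Rightarrow> ('x \<Rightarrow> 'g) \<Rightarrow>
    'g \<Rightarrow> ('g, 'x) edge list \<Rightarrow> bool"
  where "simple_cycle X G \<iota> g p \<longleftrightarrow> path X G \<iota> g p g \<and> distinct (map fst p)"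

text \<open>A single letter whose value in \<open>G\<close> is trivial labels a loop and is therefore a cyclic word.\<close>

definition cyclic_word :: "'x set \<Rightarrow> ('g, 'b) monoid_scheme \<Rightarrow> ('x \<Rightarrow> 'g) \<Rightarrow> 'x word \<Rightarrow> bool"
  where "cyclic_word X G \<iota> w \<longleftrightarrow>
    w \<in> words X \<and> cyclically_reduced w \<and> (\<exists>g p. simple_cycle X G \<iota> g p \<and> map snd p = w)"

text \<open>A graph is given by its set of vertices and its set of edges.\<close>

type_synonym ('g, 'x) graph = "'g set \<times> ('g, 'x) edge set"

definition subgraph :: "'x set \<Rightarrow> ('g, 'b) monoid_scheme \<Rightarrow> ('x \<Rightarrow> 'g) \<Rightarrow> ('g, 'x) graph \<Rightarrow> bool"
  where "subgraph X G \<iota> \<Gamma> \<longleftrightarrow>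
    fst \<Gamma> \<subseteq> carrier G \<and> snd \<Gamma> \<subseteq> cay_edges X G \<and>
    (\<forall>e \<in> snd \<Gamma>. fst e \<in> fst \<Gamma> \<and> tgt G \<iota> e \<in> fst \<Gamma> \<and> einv G \<iota> e \<in> snd \<Gamma>)"

definition connected_graph ::
    "'x set \<Rightarrow> ('g, 'b) monoid_scheme \<Rightarrow> ('x \<Rightarrow> 'g) \<Rightarrow> ('g, 'x) graph \<Rightarrow> bool"
  where "connected_graph X G \<iota> \<Gamma> \<longleftrightarrow>
    (\<forall>g \<in> fst \<Gamma>. \<forall>h \<in> fst \<Gamma>. \<exists>p. path X G \<iota> g p h \<and> set p \<subseteq> snd \<Gamma>)"

definition finite_graph :: "('g, 'x) graph \<Rightarrow> bool"
  where "finite_graph \<Gamma> \<longleftrightarrow> finite (fst \<Gamma>) \<and> finite (snd \<Gamma>)"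

definition graph_union :: "('g, 'x) graph \<Rightarrow> ('g, 'x) graph \<Rightarrow> ('g, 'x) graph"
  where "graph_union \<Delta> \<Xi> = (fst \<Delta> \<union> fst \<Xi>, snd \<Delta> \<union> snd \<Xi>)"

definition translate :: "('g, 'b) monoid_scheme \<Rightarrow> 'g \<Rightarrow> ('g, 'x) graph \<Rightarrow> ('g, 'x) graph"
  where "translate G g \<Gamma> =
    ((\<lambda>h. g \<otimes>\<^bsub>G\<^esub> h) ` fst \<Gamma>, (\<lambda>(h, a). (g \<otimes>\<^bsub>G\<^esub> h, a)) ` snd \<Gamma>)"

definition spanned :: "('g, 'b) monoid_scheme \<Rightarrow> ('x \<Rightarrow> 'g) \<Rightarrow>
    'g \<Rightarrow> ('g, 'x) edge list \<Rightarrow> ('g, 'x) graph"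
  where "spanned G \<iota> g p = (insert g (tgt G \<iota> ` set p), set p \<union> einv G \<iota> ` set p)"

section \<open>The Margolis--Meakin expansion and its quotient\<close>

definition MM :: "'x set \<Rightarrow> ('g, 'b) monoid_scheme \<Rightarrow> ('x \<Rightarrow> 'g) \<Rightarrow> (('g, 'x) graph \<times> 'g) monoid"
  where "MM X G \<iota> =
    \<lparr>carrier = {(\<Gamma>, g). subgraph X G \<iota> \<Gamma> \<and> finite_graph \<Gamma> \<and> connected_graph X G \<iota> \<Gamma> \<and>
                      \<one>\<^bsub>G\<^esub> \<in> fst \<Gamma> \<and> g \<in> fst \<Gamma>},
     mult = (\<lambda>(\<Delta>, g) (\<Xi>, h). (graph_union \<Delta> (translate G g \<Xi>), g \<otimes>\<^bsub>G\<^esub> h)),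
     one = (({\<one>\<^bsub>G\<^esub>}, {}), \<one>\<^bsub>G\<^esub>)\<rparr>"

definition MM_gen :: "('g, 'b) monoid_scheme \<Rightarrow> ('x \<Rightarrow> 'g) \<Rightarrow> 'x \<Rightarrow> ('g, 'x) graph \<times> 'g"
  where "MM_gen G \<iota> x = (spanned G \<iota> \<one>\<^bsub>G\<^esub> [(\<one>\<^bsub>G\<^esub>, (x, True))], \<iota> x)"

definition xi :: "'x set \<Rightarrow> ('g, 'b) monoid_scheme \<Rightarrow> ('x \<Rightarrow> 'g) \<Rightarrow>
    ((('g, 'x) graph \<times> 'g) \<times> (('g, 'x) graph \<times> 'g)) set"
  where "xi X G \<iota> = cong_gen (MM X G \<iota>)
    {((spanned G \<iota> \<one>\<^bsub>G\<^esub> p, g), (spanned G \<iota> \<one>\<^bsub>G\<^esub> q, g)) | p q g.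
       simple_path X G \<iota> \<one>\<^bsub>G\<^esub> p g \<and> simple_path X G \<iota> \<one>\<^bsub>G\<^esub> q g}"

definition MsF :: "'x set \<Rightarrow> ('g, 'b) monoid_scheme \<Rightarrow> ('x \<Rightarrow> 'g) \<Rightarrow>
    (('g, 'x) graph \<times> 'g) set monoid"
  where "MsF X G \<iota> = quot_monoid (MM X G \<iota>) (xi X G \<iota>)"

definition MsF_gen :: "'x set \<Rightarrow> ('g, 'b) monoid_scheme \<Rightarrow> ('x \<Rightarrow> 'g) \<Rightarrow>
    'x \<Rightarrow> (('g, 'x) graph \<times> 'g) set"
  where "MsF_gen X G \<iota> x = xi X G \<iota> `` {MM_gen G \<iota> x}"

end

(*
A word w represents an element of M(G, X) through the subgraph spanned by its path from 1; M_sF(G, X)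
and the presented inverse monoid are both quotients of the word monoid, so it suffices to show that
they have the same kernel.  The relations hold in M_sF because both parts of a relator cycle cut at
two vertices are simple paths.

For the converse, call edges of the Cayley graph equivalent if they lie in the same block, where
blocks are generated by consecutive edges of relator cycles.  For a block K, the signed count of the
K-edges entering a vertex (or a class of germs at a vertex) along a path depends only on the element
of G represented by its label, because relator cycles lie inside or outside of K.  Hence paths
avoiding K between vertices of K are closed, a block has a single class of germs at each vertex, and
simple paths with the same endpoints meet the same blocks.  In the presented monoid, deleting the
edges outside of K transforms a derivation of a relation of G into one absorbed by the idempotent of
any edge in K, so that closed paths in K are idempotent; by induction on the length all closed paths
are.  It follows that words with the same value in G whose paths meet the same blocks are equal, and
this data is an invariant of the generating pairs of M_sF.
*)

theory Submission
  imports Defs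
begin

section \<open>Words and quotients of monoids\<close>

text \<open>The obstacle is that a derivation of a relation of G inserts and deletes
  \<open>a a^-1\<close> anywhere, whereas in an inverse monoid such an insertion changes the element
  unless the word already absorbs it. Inside one block it is harmless. For a relator
  \<open>b c s\<close> the relations give c = b^-1 s^-1 and b^-1 = c s, so the germs b^-1 and c
  generate the same right ideal, and once one edge of a block has been read, a detour along a
  further edge of that block is free. A derivation may however wander through blocks that the two
  words never meet; this is why it is projected to a single block before it is used.

  The projection needs blocks to be separated like the pieces of a graph between its cut vertices.
  As blocks are generated by relators and not defined by separation, this has to come from the
  presentation: the signed count is additive along paths and vanishes on \<open>a a^-1\<close> and
  on relators. Its two test functions, the indicator of a vertex and the indicator of a class of
  germs at a vertex, yield the two separation properties.\<close>

lemma linv_linv [simp]: "linv (linv a) = a"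
  by (simp add: linv_def)

lemma winv_Nil [simp]: "winv [] = []"
  by (simp add: winv_def)

lemma winv_Cons [simp]: "winv (a # u) = winv u @ [linv a]"
  by (simp add: winv_def)

lemma winv_append [simp]: "winv (u @ v) = winv v @ winv u"
  by (simp add: winv_def)

lemma winv_winv [simp]: "winv (winv u) = u"
  by (induction u) auto

lemma linv_letters [simp]: "linv a \<in> letters X \<longleftrightarrow> a \<in> letters X"
  by (cases a) (auto simp: linv_def letters_def)

lemma words_Nil [simp]: "[] \<in> words X"
  by (simp add: words_def)

lemma words_Cons [simp]: "a # u \<in> words X \<longleftrightarrow> a \<in> letters X \<and> u \<in> words X"
  by (simp add: words_def)

lemma words_append [simp]: "u @ v \<in> words X \<longleftrightarrow> u \<in> words X \<and> v \<in> words X"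
  by (simp add: words_def)

lemma words_winv [simp]: "winv u \<in> words X \<longleftrightarrow> u \<in> words X"
  by (induction u) auto

lemma filter_letters_words [simp]: "filter (\<lambda>a. a \<in> letters X) u \<in> words X"
  by (induction u) auto

lemma filter_letters_id: "u \<in> words X \<Longrightarrow> filter (\<lambda>a. a \<in> letters X) u = u"
  by (induction u) auto

lemma filter_letters_winv: "filter (\<lambda>a. a \<in> letters X) (winv u) = winv (filter (\<lambda>a. a \<in> letters X) u)"
  by (induction u) auto

lemma cyclic_conjugate_rotate:
  assumes "cyclic_conjugate (u @ v) r"
  shows "cyclic_conjugate (v @ u) r"
proof -
  obtain x y where xy: "u @ v = x @ y" "r = y @ x"
    using assms by (auto simp: cyclic_conjugate_def)
  from xy(1) consider t where "x = u @ t" "v = t @ y" | t where "u = x @ t" "y = t @ v"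
    by (auto simp: append_eq_append_conv2)
  then show ?thesis
  proof cases
    case 1
    then show ?thesis
      unfolding cyclic_conjugate_def xy(2) by (intro exI[of _ t] exI[of _ "y @ u"]) simp
  next
    case 2
    then show ?thesis
      unfolding cyclic_conjugate_def xy(2) by (intro exI[of _ "v @ x"] exI[of _ t]) simp
  qed
qed

lemma monoid_word_monoid: "monoid (word_monoid X)"
  by unfold_locales (auto simp: word_monoid_def)

lemma word_monoid_simps [simp]:
  "carrier (word_monoid X) = words X" "u \<otimes>\<^bsub>word_monoid X\<^esub> v = u @ v" "\<one>\<^bsub>word_monoid X\<^esub> = []"
  by (simp_all add: word_monoid_def)

section \<open>Generated congruences and iterated quotients\<close>

context monoid
begin

lemma cong_gen_carrier:
  assumes "(a, b) \<in> cong_gen G R"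
  shows "a \<in> carrier G \<and> b \<in> carrier G"
  using assms by induction auto

lemma equiv_cong_gen: "equiv (carrier G) (cong_gen G R)"
proof (rule equivI)
  show "refl_on (carrier G) (cong_gen G R)"
    by (auto simp: refl_on_def intro: cong_gen.refl)
  show "sym (cong_gen G R)"
    by (rule symI) (rule cong_gen.sym)
  show "trans (cong_gen G R)"
    by (rule transI) (rule cong_gen.trans)
qed (auto dest: cong_gen_carrier)

lemma cong_class_eq_iff:
  assumes "a \<in> carrier G" "b \<in> carrier G"
  shows "cong_gen G R `` {a} = cong_gen G R `` {b} \<longleftrightarrow> (a, b) \<in> cong_gen G R"
  using equiv_class_eq_iff[OF equiv_cong_gen] assms by blast

lemma quot_carrier:
  "A \<in> carrier (quot_monoid G (cong_gen G R)) \<longleftrightarrow> (\<exists>a\<in>carrier G. A = cong_gen G R `` {a})"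
  by (auto simp: quot_monoid_def quotient_def)

lemma class_in_quot [simp]:
  "a \<in> carrier G \<Longrightarrow> cong_gen G R `` {a} \<in> carrier (quot_monoid G (cong_gen G R))"
  by (auto simp: quot_carrier)

lemma quot_one: "\<one>\<^bsub>quot_monoid G (cong_gen G R)\<^esub> = cong_gen G R `` {\<one>}"
  by (simp add: quot_monoid_def)

lemma quot_mult:
  assumes "a \<in> carrier G" "b \<in> carrier G"
  shows "cong_gen G R `` {a} \<otimes>\<^bsub>quot_monoid G (cong_gen G R)\<^esub> cong_gen G R `` {b} =
    cong_gen G R `` {a \<otimes> b}"
proof -
  have "cong_gen G R `` {a' \<otimes> b'} = cong_gen G R `` {a \<otimes> b}"
    if "(a, a') \<in> cong_gen G R" "(b, b') \<in> cong_gen G R" for a' b'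
    using cong_gen.sym[OF cong_gen.mult[OF that]] that[THEN cong_gen_carrier] assms
    by (subst cong_class_eq_iff) auto
  then have "(\<Union>x\<in>cong_gen G R `` {a}. \<Union>y\<in>cong_gen G R `` {b}. cong_gen G R `` {x \<otimes> y}) =
      (\<Union>x\<in>cong_gen G R `` {a}. \<Union>y\<in>cong_gen G R `` {b}. cong_gen G R `` {a \<otimes> b})"
    by (intro SUP_cong HOL.refl) simp
  moreover have "a \<in> cong_gen G R `` {a}" "b \<in> cong_gen G R `` {b}"
    using assms by (simp_all add: cong_gen.refl)
  ultimately show ?thesis
    unfolding quot_monoid_def by (simp only: partial_object.simps monoid.simps) (subst UN_constant, force)+
qed

lemma monoid_quot: "monoid (quot_monoid G (cong_gen G R))" (is "monoid ?Q")
proof (rule monoidI)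
  show "A \<otimes>\<^bsub>?Q\<^esub> B \<in> carrier ?Q" if "A \<in> carrier ?Q" "B \<in> carrier ?Q" for A B
    using that by (auto simp: quot_carrier quot_mult)
  show "\<one>\<^bsub>?Q\<^esub> \<in> carrier ?Q"
    by (auto simp: quot_one)
  show "A \<otimes>\<^bsub>?Q\<^esub> B \<otimes>\<^bsub>?Q\<^esub> C = A \<otimes>\<^bsub>?Q\<^esub> (B \<otimes>\<^bsub>?Q\<^esub> C)"
    if "A \<in> carrier ?Q" "B \<in> carrier ?Q" "C \<in> carrier ?Q" for A B C
    using that by (auto simp: quot_carrier quot_mult m_assoc)
  show "\<one>\<^bsub>?Q\<^esub> \<otimes>\<^bsub>?Q\<^esub> A = A" "A \<otimes>\<^bsub>?Q\<^esub> \<one>\<^bsub>?Q\<^esub> = A" if "A \<in> carrier ?Q" for A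
    using that by (auto simp: quot_carrier quot_one quot_mult)
qed

lemma quot_class_hom: "(\<lambda>a. cong_gen G R `` {a}) \<in> hom G (quot_monoid G (cong_gen G R))"
  by (auto simp: hom_def quot_mult)

text \<open>Third isomorphism theorem for generated congruences: \<open>Gp\<close> and
  \<open>Inv\<close> are quotients of quotients of the word monoid, and this flattens them to one
  congruence on words. The induction treats all representatives of the two classes at once, since a
  transitive step needs a common element of the middle class.\<close>

lemma quot_quot_class_eq_iff:
  fixes R S
  defines "Q \<equiv> quot_monoid G (cong_gen G R)"
  defines "T \<equiv> {(cong_gen G R `` {u}, cong_gen G R `` {v}) | u v. (u, v) \<in> S}"
  assumes ab: "a \<in> carrier G" "b \<in> carrier G" and S: "S \<subseteq> carrier G \<times> carrier G"
  shows "cong_gen Q T `` {cong_gen G R `` {a}} = cong_gen Q T `` {cong_gen G R `` {b}} \<longleftrightarrow>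
    (a, b) \<in> cong_gen G (R \<union> S)"
proof -
  interpret Q: monoid Q
    unfolding Q_def by (rule monoid_quot)
  have mono: "(x, y) \<in> cong_gen G (R \<union> S)" if "(x, y) \<in> cong_gen G R" for x y
    using that by induction (auto intro: cong_gen.intros)
  have "(x, y) \<in> cong_gen G (R \<union> S)"
    if "(A, B) \<in> cong_gen Q T" "x \<in> A" "y \<in> B" for A B x y
    using that
  proof (induction arbitrary: x y)
    case (base A B)
    then obtain u v where "(u, v) \<in> S" "(u, x) \<in> cong_gen G R" "(v, y) \<in> cong_gen G R"
      by (auto simp: T_def)
    moreover from this have "(u, v) \<in> cong_gen G (R \<union> S)"
      using S by (auto intro: cong_gen.base)
    ultimately show ?case
      by (meson mono cong_gen.sym cong_gen.trans)
  next
    case (refl A)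
    then obtain z where "(z, x) \<in> cong_gen G R" "(z, y) \<in> cong_gen G R"
      by (auto simp: Q_def quot_carrier)
    then show ?case
      by (meson mono cong_gen.sym cong_gen.trans)
  next
    case (sym A B)
    then show ?case
      by (meson cong_gen.sym)
  next
    case (trans A B C)
    have "B \<in> carrier Q"
      using trans Q.cong_gen_carrier by blast
    then obtain z where "z \<in> carrier G" "B = cong_gen G R `` {z}"
      by (auto simp: Q_def quot_carrier)
    then have "z \<in> B"
      by (auto intro: cong_gen.refl)
    then show ?case
      using trans.IH trans.prems by (meson cong_gen.trans)
  next
    case (mult A B C D)
    have "A \<in> carrier Q" "B \<in> carrier Q" "C \<in> carrier Q" "D \<in> carrier Q"
      using mult Q.cong_gen_carrier by blast+
    then obtain p q r s where car: "p \<in> carrier G" "q \<in> carrier G" "r \<in> carrier G" "s \<in> carrier G"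
      and eq: "A = cong_gen G R `` {p}" "B = cong_gen G R `` {q}"
        "C = cong_gen G R `` {r}" "D = cong_gen G R `` {s}"
      by (auto simp: Q_def quot_carrier)
    have "(p \<otimes> r, x) \<in> cong_gen G R" "(q \<otimes> s, y) \<in> cong_gen G R"
      using mult.prems car by (auto simp: eq Q_def quot_mult)
    moreover have "(p, q) \<in> cong_gen G (R \<union> S)" "(r, s) \<in> cong_gen G (R \<union> S)"
      using mult.IH(1)[of p q] mult.IH(2)[of r s] car by (simp_all add: eq cong_gen.refl)
    ultimately show ?case
      by (meson mono cong_gen.sym cong_gen.trans cong_gen.mult)
  qed
  moreover have "(cong_gen G R `` {x}, cong_gen G R `` {y}) \<in> cong_gen Q T"
    if "(x, y) \<in> cong_gen G (R \<union> S)" for x y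
    using that
  proof induction
    case (base a b)
    show ?case
    proof (cases "(a, b) \<in> R")
      case True
      then have "cong_gen G R `` {a} = cong_gen G R `` {b}"
        using base by (subst cong_class_eq_iff) (auto intro: cong_gen.base)
      then show ?thesis
        using base by (auto simp: Q_def intro!: cong_gen.refl)
    next
      case False
      then show ?thesis
        using base by (intro cong_gen.base) (auto simp: Q_def T_def)
    qed
  next
    case (refl a)
    then show ?case by (auto simp: Q_def intro: cong_gen.refl)
  next
    case (sym a b)
    show ?case by (rule cong_gen.sym) fact
  next
    case (trans a b c)
    show ?case by (rule cong_gen.trans) fact+
  next
    case (mult a b c d)
    then have "a \<in> carrier G" "b \<in> carrier G" "c \<in> carrier G" "d \<in> carrier G"
      by (auto dest: cong_gen_carrier)
    then show ?case
      using cong_gen.mult[OF mult.IH] by (simp add: Q_def quot_mult)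
  qed
  moreover have "a \<in> cong_gen G R `` {a}" "b \<in> cong_gen G R `` {b}"
    using ab by (auto intro: cong_gen.refl)
  ultimately show ?thesis
    using ab by (subst Q.cong_class_eq_iff) (auto simp: Q_def)
qed

lemma quot_carrier_image:
  "carrier (quot_monoid G (cong_gen G R)) = (\<lambda>a. cong_gen G R `` {a}) ` carrier G"
  by (auto simp: quot_carrier)

lemma quot_quot_class_hom:
  fixes R T
  defines "Q \<equiv> quot_monoid G (cong_gen G R)"
  shows "(\<lambda>a. cong_gen Q T `` {cong_gen G R `` {a}}) \<in> hom G (quot_monoid Q (cong_gen Q T))"
proof -
  interpret Q: monoid Q
    unfolding Q_def by (rule monoid_quot)
  show ?thesis
    using hom_compose[OF quot_class_hom[of R, folded Q_def] Q.quot_class_hom[of T]] by (simp add: comp_def)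
qed

lemma quot_quot_class_surj:
  fixes R T
  defines "Q \<equiv> quot_monoid G (cong_gen G R)"
  shows "(\<lambda>a. cong_gen Q T `` {cong_gen G R `` {a}}) ` carrier G =
    carrier (quot_monoid Q (cong_gen Q T))"
proof -
  interpret Q: monoid Q
    unfolding Q_def by (rule monoid_quot)
  show ?thesis
    using Q.quot_carrier_image[of T] quot_carrier_image[of R, folded Q_def] by (simp add: image_image)
qed

end

text \<open>The source of the final isomorphism: both monoids are images of the words, so only
  kernels have to be compared. \<open>\<phi>\<close> picks a preimage under \<open>\<pi>\<close>,
  and equality of the kernels makes the choice irrelevant.\<close>

lemma iso_of_equal_kernels:
  assumes \<pi>: "\<pi> \<in> hom W Q" "\<pi> ` carrier W = carrier Q"
    and \<psi>: "\<psi> \<in> hom W N" "\<psi> ` carrier W = carrier N"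
    and W: "monoid W"
    and ker: "\<And>u v. u \<in> carrier W \<Longrightarrow> v \<in> carrier W \<Longrightarrow> \<pi> u = \<pi> v \<longleftrightarrow> \<psi> u = \<psi> v"
  shows "\<exists>\<phi>\<in>iso Q N. \<forall>u\<in>carrier W. \<phi> (\<pi> u) = \<psi> u"
proof -
  define \<phi> where "\<phi> = \<psi> \<circ> inv_into (carrier W) \<pi>"
  have inv: "inv_into (carrier W) \<pi> (\<pi> u) \<in> carrier W \<and> \<pi> (inv_into (carrier W) \<pi> (\<pi> u)) = \<pi> u"
    if "u \<in> carrier W" for u
    using that by (auto intro: inv_into_into f_inv_into_f)
  have \<phi>: "\<phi> (\<pi> u) = \<psi> u" if "u \<in> carrier W" for u
    using inv[OF that] ker that by (auto simp: \<phi>_def)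
  have "\<phi> \<in> hom Q N"
  proof (rule homI)
    show "\<phi> x \<in> carrier N" if "x \<in> carrier Q" for x
    proof -
      have "x \<in> \<pi> ` carrier W"
        using that by (simp add: \<pi>(2))
      then obtain u where "u \<in> carrier W" "x = \<pi> u"
        by blast
      then show ?thesis
        using \<phi>[of u] imageI[of u "carrier W" \<psi>] \<psi>(2) by simp
    qed
    show "\<phi> (x \<otimes>\<^bsub>Q\<^esub> y) = \<phi> x \<otimes>\<^bsub>N\<^esub> \<phi> y" if "x \<in> carrier Q" "y \<in> carrier Q" for x y
    proof -
      have "x \<in> \<pi> ` carrier W" "y \<in> \<pi> ` carrier W"
        using that by (simp_all add: \<pi>(2))
      then obtain u v where uv: "u \<in> carrier W" "v \<in> carrier W" "x = \<pi> u" "y = \<pi> v"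
        by blast
      then have "\<pi> u \<otimes>\<^bsub>Q\<^esub> \<pi> v = \<pi> (u \<otimes>\<^bsub>W\<^esub> v)" "\<psi> (u \<otimes>\<^bsub>W\<^esub> v) = \<psi> u \<otimes>\<^bsub>N\<^esub> \<psi> v"
        using \<pi>(1) \<psi>(1) by (auto simp: hom_def)
      then show ?thesis
        using uv \<phi> monoid.m_closed[OF W] by simp
    qed
  qed
  moreover have "inj_on \<phi> (carrier Q)"
    unfolding \<pi>(2)[symmetric] by (auto simp: inj_on_def \<phi> ker)
  moreover have "\<phi> ` carrier Q = carrier N"
    unfolding \<pi>(2)[symmetric] \<psi>(2)[symmetric] image_image using \<phi> by (auto simp: image_def)
  ultimately show ?thesis
    using \<phi> by (auto simp: iso_def bij_betw_def)
qed

section \<open>Inverse monoid congruences on words\<close>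

text \<open>The relation lives on all lists and not only on \<open>words X\<close>, which frees the
  calculations from membership conditions. The axioms make the quotient an inverse monoid whose
  inversion is induced by \<open>winv\<close>.\<close>

locale wagner_congruence =
  fixes eqv :: "'x word \<Rightarrow> 'x word \<Rightarrow> bool"  (infix "\<approx>" 50)
  assumes eqv_refl [simp, intro]: "u \<approx> u"
    and eqv_sym: "u \<approx> v \<Longrightarrow> v \<approx> u"
    and eqv_trans [trans]: "u \<approx> v \<Longrightarrow> v \<approx> w \<Longrightarrow> u \<approx> w"
    and append: "u \<approx> u' \<Longrightarrow> v \<approx> v' \<Longrightarrow> u @ v \<approx> u' @ v'"
    and regular: "u @ winv u @ u \<approx> u"
    and commute: "u @ winv u @ v @ winv v \<approx> v @ winv v @ u @ winv u"
begin

lemma ctxt: "u \<approx> v \<Longrightarrow> p @ u @ q \<approx> p @ v @ q"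
  by (simp add: append)

text \<open>The axiom \<open>commute\<close> only speaks of idempotents of the shape u u^-1, so
  every idempotent has to be brought to this shape. For f = e^-1 it gives f e e f = e f f e, and the
  left side is f because e is idempotent. Thus f begins and ends with e and absorbs e on both sides,
  whence e = e f e = e f.\<close>

lemma idempotent_imp_projection:
  assumes "e @ e \<approx> e"
  shows "e \<approx> e @ winv e"
proof -
  define f where "f = winv e"
  have efe: "e @ f @ e \<approx> e" and fef: "f @ e @ f \<approx> f"
    using regular[of e] regular[of "winv e"] by (simp_all add: f_def)
  have comm: "f @ e @ e @ f \<approx> e @ f @ f @ e"
    using commute[of f e] by (simp add: f_def)
  have f: "f \<approx> e @ f @ f @ e"
  proof -
    have "f \<approx> f @ e @ f" using fef eqv_sym by blast
    also have "f @ e @ f \<approx> f @ e @ e @ f"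
      using ctxt[OF eqv_sym[OF assms], of f f] by simp
    also note comm
    finally show ?thesis .
  qed
  have "e @ f \<approx> e @ e @ f @ f @ e"
    using ctxt[OF f, of e "[]"] by simp
  also have "\<dots> \<approx> e @ f @ f @ e"
    using ctxt[OF assms, of "[]" "f @ f @ e"] by simp
  also have "\<dots> \<approx> f" using f eqv_sym by blast
  finally have ef: "e @ f \<approx> f" .
  have "f @ e \<approx> e @ f @ f @ e @ e"
    using ctxt[OF f, of "[]" e] by simp
  also have "\<dots> \<approx> e @ f @ f @ e"
    using ctxt[OF assms, of "e @ f @ f" "[]"] by simp
  also have "\<dots> \<approx> f" using f eqv_sym by blast
  finally have fe: "f @ e \<approx> f" .
  have "e \<approx> e @ f @ e" using efe eqv_sym by blast
  also have "\<dots> \<approx> e @ f" using ctxt[OF fe, of e "[]"] by simp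
  finally show ?thesis by (simp add: f_def)
qed

lemma idempotents_commute:
  assumes "e @ e \<approx> e" "f @ f \<approx> f"
  shows "e @ f \<approx> f @ e"
proof -
  note e = idempotent_imp_projection[OF assms(1)] and f = idempotent_imp_projection[OF assms(2)]
  have "e @ f \<approx> e @ winv e @ f @ winv f"
    using append[OF e f] by simp
  also note commute
  also have "f @ winv f @ e @ winv e \<approx> f @ e"
    using eqv_sym[OF append[OF f e]] by simp
  finally show ?thesis .
qed

lemma inverse_unique:
  assumes aba: "a @ b @ a \<approx> a" and bab: "b @ a @ b \<approx> b"
    and aca: "a @ c @ a \<approx> a" and cac: "c @ a @ c \<approx> c"
  shows "b \<approx> c"
proof -
  have idem: "(a @ b) @ (a @ b) \<approx> a @ b" "(a @ c) @ (a @ c) \<approx> a @ c"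
    "(b @ a) @ (b @ a) \<approx> b @ a" "(c @ a) @ (c @ a) \<approx> c @ a"
    using ctxt[OF aba, of "[]" b] ctxt[OF aca, of "[]" c] ctxt[OF aba, of b "[]"]
      ctxt[OF aca, of c "[]"] by simp_all
  have "b \<approx> b @ a @ b" by (rule eqv_sym[OF bab])
  also have "\<dots> \<approx> b @ a @ c @ a @ b"
    using ctxt[OF eqv_sym[OF aca], of b b] by simp
  also have "\<dots> \<approx> b @ a @ b @ a @ c"
    using ctxt[OF idempotents_commute[OF idem(2,1)], of b "[]"] by simp
  also have "\<dots> \<approx> b @ a @ c"
    using ctxt[OF bab, of "[]" "a @ c"] by simp
  finally have b: "b \<approx> b @ a @ c" .
  have "c \<approx> c @ a @ c" by (rule eqv_sym[OF cac])
  also have "\<dots> \<approx> c @ a @ b @ a @ c"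
    using ctxt[OF eqv_sym[OF aba], of c c] by simp
  also have "\<dots> \<approx> b @ a @ c @ a @ c"
    using ctxt[OF idempotents_commute[OF idem(4,3)], of "[]" c] by simp
  also have "\<dots> \<approx> b @ a @ c"
    using ctxt[OF cac, of "b @ a" "[]"] by simp
  finally show ?thesis
    using b eqv_sym eqv_trans by blast
qed

lemma inverse_eqv_winv:
  assumes "a @ b @ a \<approx> a" "b @ a @ b \<approx> b"
  shows "b \<approx> winv a"
  using inverse_unique[OF assms regular] regular[of "winv a"] by simp

lemma winv_cong:
  assumes "u \<approx> v"
  shows "winv u \<approx> winv v"
proof (rule inverse_eqv_winv)
  have "v @ winv u @ v \<approx> u @ winv u @ u"
    using append[OF eqv_sym[OF assms] append[OF eqv_refl[of "winv u"] eqv_sym[OF assms]]] .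
  also note regular
  also note assms
  finally show "v @ winv u @ v \<approx> v" .
  have "winv u @ v @ winv u \<approx> winv u @ u @ winv u"
    using ctxt[OF eqv_sym[OF assms]] .
  also have "\<dots> \<approx> winv u"
    using regular[of "winv u"] by simp
  finally show "winv u @ v @ winv u \<approx> winv u" .
qed

text \<open>In the quotient this is the order of Green's relation R: p lies in the right ideal of q,
  or p p^-1 is below q q^-1. For paths it means that reading q and returning before p adds
  nothing.\<close>

definition absorbs :: "'x word \<Rightarrow> 'x word \<Rightarrow> bool"
  where "absorbs p q \<longleftrightarrow> q @ winv q @ p \<approx> p"

lemma absorbs_refl: "absorbs p p"
  by (simp add: absorbs_def regular)

lemma absorbs_trans:
  assumes "absorbs p q" "absorbs q r"
  shows "absorbs p r"
proof -
  have p: "q @ winv q @ p \<approx> p" and q: "r @ winv r @ q \<approx> q"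
    using assms by (auto simp: absorbs_def)
  have "r @ winv r @ p \<approx> r @ winv r @ q @ winv q @ p"
    using ctxt[OF eqv_sym[OF p], of "r @ winv r" "[]"] by simp
  also have "\<dots> \<approx> q @ winv q @ p"
    using ctxt[OF q, of "[]" "winv q @ p"] by simp
  also note p
  finally show ?thesis by (simp add: absorbs_def)
qed

lemma absorbs_append: "absorbs p q \<Longrightarrow> absorbs (p @ s) q"
  using ctxt[of "q @ winv q @ p" p "[]" s] by (simp add: absorbs_def)

lemma absorbs_prefix: "absorbs (p @ s) p"
  by (rule absorbs_append[OF absorbs_refl])

text \<open>Clear in terms of right ideals. In words, \<open>winv s @ s\<close> has to be commuted
  past \<open>q @ winv q\<close> before s can absorb it.\<close>

lemma absorbs_left:
  assumes "absorbs p q"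
  shows "absorbs (s @ p) (s @ q)"
proof -
  have p: "q @ winv q @ p \<approx> p"
    using assms by (simp add: absorbs_def)
  have "s @ q @ winv q @ winv s @ s @ p \<approx> s @ (q @ winv q @ winv s @ s) @ q @ winv q @ p"
    using ctxt[OF eqv_sym[OF p], of "s @ q @ winv q @ winv s @ s" "[]"] by simp
  also have "\<dots> \<approx> s @ (winv s @ s @ q @ winv q) @ q @ winv q @ p"
    using ctxt[OF commute[of q "winv s"], of s "q @ winv q @ p"] by simp
  also have "\<dots> \<approx> s @ q @ winv q @ q @ winv q @ p"
    using ctxt[OF regular[of s], of "[]" "q @ winv q @ q @ winv q @ p"] by simp
  also have "\<dots> \<approx> s @ q @ winv q @ p"
    using ctxt[OF regular[of q], of s "winv q @ p"] by simp
  also have "\<dots> \<approx> s @ p"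
    using ctxt[OF p, of s "[]"] by simp
  finally show ?thesis by (simp add: absorbs_def)
qed

lemma absorbs_cong:
  assumes "absorbs p q" "p \<approx> p'" "q \<approx> q'"
  shows "absorbs p' q'"
proof -
  have "q' @ winv q' @ p' \<approx> q @ winv q @ p"
    by (intro append winv_cong eqv_sym[OF assms(2)] eqv_sym[OF assms(3)])
  also have "\<dots> \<approx> p" using assms by (simp add: absorbs_def)
  also note assms(2)
  finally show ?thesis by (simp add: absorbs_def)
qed

text \<open>Conjugation by d moves z to the front: d z s equals \<open>f\<close> (d s) with the
  idempotent \<open>f\<close> = d z z^-1 d^-1, and a product of two commuting idempotents is
  idempotent. Used to insert a closed excursion z into a closed path d s.\<close>

lemma insert_idempotent:
  assumes z: "z @ z \<approx> z" and ds: "(d @ s) @ (d @ s) \<approx> d @ s"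
  shows "(d @ z @ s) @ (d @ z @ s) \<approx> d @ z @ s"
proof -
  have zp: "z \<approx> z @ winv z" by (rule idempotent_imp_projection[OF z])
  define f where "f = d @ z @ winv z @ winv d"
  have ff: "f @ f \<approx> f"
    using ctxt[OF regular[of "d @ z"], of "[]" "winv (d @ z)"] by (simp add: f_def)
  have "d @ z @ s \<approx> d @ z @ winv z @ s"
    using ctxt[OF zp, of d s] by simp
  also have "\<dots> \<approx> d @ winv d @ d @ z @ winv z @ s"
    using ctxt[OF eqv_sym[OF regular[of d]], of "[]" "z @ winv z @ s"] by simp
  also have "\<dots> \<approx> d @ z @ winv z @ winv d @ d @ s"
    using ctxt[OF commute[of "winv d" z], of d s] by simp
  finally have x: "d @ z @ s \<approx> f @ (d @ s)" by (simp add: f_def)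
  have "(d @ z @ s) @ (d @ z @ s) \<approx> (f @ (d @ s)) @ (f @ (d @ s))"
    by (rule append[OF x x])
  also have "\<dots> \<approx> f @ f @ (d @ s) @ (d @ s)"
    using ctxt[OF idempotents_commute[OF ds ff], of f "d @ s"] by simp
  also have "\<dots> \<approx> f @ (d @ s)"
    using append[OF ff ds] by simp
  also note eqv_sym[OF x]
  finally show ?thesis .
qed

text \<open>With \<open>j\<close> = u^-1 v the two absorptions read v = u j and u = v j^-1. An
  idempotent is its own inverse, so u = v j = u j j = u j = v.\<close>

lemma eqv_of_absorbs:
  assumes vu: "absorbs v u" and uv: "absorbs u v"
    and i: "(winv u @ v) @ (winv u @ v) \<approx> winv u @ v"
  shows "u \<approx> v"
proof -
  define j where "j = winv u @ v"
  have jj: "j @ j \<approx> j" using i by (simp add: j_def)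
  have jp: "j \<approx> j @ winv j" by (rule idempotent_imp_projection[OF jj])
  have jw: "winv j \<approx> j"
    using eqv_trans[OF winv_cong[OF jp]] eqv_sym[OF jp] by simp
  have v: "v \<approx> u @ j"
    using vu eqv_sym by (simp add: absorbs_def j_def)
  have "u \<approx> v @ winv j"
    using uv eqv_sym by (simp add: absorbs_def j_def)
  also have "\<dots> \<approx> v @ j" by (rule append[OF eqv_refl jw])
  also have "\<dots> \<approx> u @ j @ j" using append[OF v eqv_refl[of j]] by simp
  also have "\<dots> \<approx> u @ j" by (rule append[OF eqv_refl jj])
  also note eqv_sym[OF v]
  finally show ?thesis .
qed

lemma generated_inverse_monoid_of_words:
  assumes N: "monoid N" and \<psi>: "\<psi> \<in> hom (word_monoid X) N" and one: "\<psi> [] = \<one>\<^bsub>N\<^esub>"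
    and surj: "\<psi> ` words X = carrier N"
    and ker: "\<And>u v. u \<in> words X \<Longrightarrow> v \<in> words X \<Longrightarrow> \<psi> u = \<psi> v \<longleftrightarrow> u \<approx> v"
    and gen: "\<And>x. x \<in> X \<Longrightarrow> \<iota> x = \<psi> [(x, True)]"
  shows "generated_inverse_monoid X N \<iota>"
proof -
  have closed: "\<psi> u \<in> carrier N" if "u \<in> words X" for u
    using hom_in_carrier[OF \<psi>] that by simp
  have mult: "\<psi> u \<otimes>\<^bsub>N\<^esub> \<psi> v = \<psi> (u @ v)" if "u \<in> words X" "v \<in> words X" for u v
    using hom_mult[OF \<psi>] that by simp
  have is_inv: "is_inverse N (\<psi> u) (\<psi> v) \<longleftrightarrow> u @ v @ u \<approx> u \<and> v @ u @ v \<approx> v"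
    if "u \<in> words X" "v \<in> words X" for u v
    using that by (simp add: is_inverse_def closed mult ker)
  have winv: "is_inverse N (\<psi> u) (\<psi> (winv u))" if "u \<in> words X" for u
    using that is_inv[of u "winv u"] regular[of u] regular[of "winv u"] by simp
  have "\<exists>!b. is_inverse N a b" if "a \<in> carrier N" for a
  proof -
    have "a \<in> \<psi> ` words X" using that by (simp only: surj)
    then obtain u where u: "u \<in> words X" "a = \<psi> u" by blast
    have "b = \<psi> (winv u)" if b: "is_inverse N a b" for b
    proof -
      have "b \<in> \<psi> ` words X" using b by (simp add: is_inverse_def surj)
      then obtain v where v: "v \<in> words X" "b = \<psi> v" by blast
      then show ?thesis
        using b u is_inv[of u v] inverse_eqv_winv ker[of v "winv u"] by simp
    qed
    then show ?thesis using winv u by blast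
  qed
  then have inv: "inverse_monoid N" using N by (simp add: inverse_monoid_def)
  have "\<psi> u \<in> inv_submonoid_gen N (\<iota> ` X)" if "u \<in> words X" for u
    using that
  proof (induction u)
    case Nil
    show ?case by (simp add: one inv_submonoid_gen.one)
  next
    case (Cons a u)
    obtain x b where a: "a = (x, b)" by (cases a)
    have x: "x \<in> X" using Cons.prems by (simp add: a letters_def)
    have pos: "\<psi> [(x, True)] \<in> inv_submonoid_gen N (\<iota> ` X)"
      using x gen by (intro inv_submonoid_gen.incl) auto
    have "is_inverse N (\<psi> [(x, True)]) (\<psi> [(x, False)])"
      using winv[of "[(x, True)]"] x by (simp add: linv_def letters_def)
    then have "\<psi> [a] \<in> inv_submonoid_gen N (\<iota> ` X)"
      using inv_submonoid_gen.inverse[OF pos] pos by (cases b) (simp_all add: a)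
    then show ?case
      using inv_submonoid_gen.mult[OF _ Cons.IH] mult[of "[a]" u] Cons.prems by fastforce
  qed
  moreover have "y \<in> carrier N" if "y \<in> inv_submonoid_gen N (\<iota> ` X)" for y
    using that
  proof induction
    case (incl a)
    then show ?case using gen closed by (auto simp: letters_def)
  qed (auto simp: is_inverse_def monoid.m_closed[OF N] monoid.one_closed[OF N])
  ultimately have "inv_submonoid_gen N (\<iota> ` X) = carrier N"
    by (intro equalityI subsetI) (auto simp flip: surj)
  moreover have "\<iota> \<in> X \<rightarrow> carrier N"
    using gen closed by (auto simp: letters_def)
  ultimately show ?thesis using inv by (simp add: generated_inverse_monoid_def)
qed

end

section \<open>Paths in the Cayley graph\<close>

locale cayley = group G for G (structure) and X :: "'x set" and \<iota> :: "'x \<Rightarrow> 'g" +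
  assumes \<iota>_closed: "\<iota> \<in> X \<rightarrow> carrier G"
begin

abbreviation lv :: "'x letter \<Rightarrow> 'g"
  where "lv \<equiv> letter_val G \<iota>"

abbreviation E :: "('g, 'x) edge set"
  where "E \<equiv> cay_edges X G"

fun val :: "'x word \<Rightarrow> 'g"
  where
    "val [] = \<one>"
  | "val (a # u) = lv a \<otimes> val u"

fun trace :: "'g \<Rightarrow> 'x word \<Rightarrow> ('g, 'x) edge list"
  where
    "trace g [] = []"
  | "trace g (a # u) = (g, a) # trace (g \<otimes> lv a) u"

lemma lv_closed [simp]: "a \<in> letters X \<Longrightarrow> lv a \<in> carrier G"
  using \<iota>_closed by (auto simp: letter_val_def letters_def)

lemma lv_linv [simp]: "a \<in> letters X \<Longrightarrow> lv (linv a) = inv (lv a)"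
  using \<iota>_closed by (auto simp: letter_val_def letters_def linv_def Pi_iff)

lemma val_closed [simp]: "u \<in> words X \<Longrightarrow> val u \<in> carrier G"
  by (induction u) auto

lemma val_append [simp]: "u \<in> words X \<Longrightarrow> v \<in> words X \<Longrightarrow> val (u @ v) = val u \<otimes> val v"
  by (induction u) (auto simp: m_assoc)

lemma val_winv [simp]: "u \<in> words X \<Longrightarrow> val (winv u) = inv (val u)"
  by (induction u) (auto simp: inv_mult_group)

lemma map_snd_trace [simp]: "map snd (trace g u) = u"
  by (induction u arbitrary: g) auto

lemma length_trace [simp]: "length (trace g u) = length u"
  by (metis length_map map_snd_trace)

lemma trace_append [simp]:
  "g \<in> carrier G \<Longrightarrow> u \<in> words X \<Longrightarrow> v \<in> words X \<Longrightarrow>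
    trace g (u @ v) = trace g u @ trace (g \<otimes> val u) v"
  by (induction u arbitrary: g) (auto simp: m_assoc)

lemma trace_edges: "g \<in> carrier G \<Longrightarrow> u \<in> words X \<Longrightarrow> set (trace g u) \<subseteq> E"
  by (induction u arbitrary: g) (auto simp: cay_edges_def)

lemma trace_translate:
  "h \<in> carrier G \<Longrightarrow> g \<in> carrier G \<Longrightarrow> u \<in> words X \<Longrightarrow>
    trace (h \<otimes> g) u = map (\<lambda>(k, a). (h \<otimes> k, a)) (trace g u)"
  by (induction u arbitrary: g) (auto simp: m_assoc)

lemma tgt_closed [simp]: "e \<in> E \<Longrightarrow> tgt G \<iota> e \<in> carrier G"
  by (auto simp: tgt_def cay_edges_def)

lemma einv_closed [simp]: "e \<in> E \<Longrightarrow> einv G \<iota> e \<in> E"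
  by (auto simp: tgt_def einv_def cay_edges_def)

lemma einv_einv [simp]: "e \<in> E \<Longrightarrow> einv G \<iota> (einv G \<iota> e) = e"
  by (auto simp: tgt_def einv_def cay_edges_def m_assoc)

lemma fst_einv [simp]: "fst (einv G \<iota> e) = tgt G \<iota> e"
  by (simp add: einv_def)

lemma tgt_einv [simp]: "e \<in> E \<Longrightarrow> tgt G \<iota> (einv G \<iota> e) = fst e"
  by (auto simp: tgt_def einv_def cay_edges_def m_assoc)

lemma trace_fst: "f \<in> set (trace g u) \<Longrightarrow> fst f \<in> insert g (tgt G \<iota> ` set (trace g u))"
  by (induction u arbitrary: g) (fastforce simp: tgt_def)+

lemma trace_splitE:
  assumes "trace g u = xs @ e # ys" "g \<in> carrier G" "u \<in> words X"
  obtains p a q where "u = p @ a # q" "p \<in> words X" "a \<in> letters X" "q \<in> words X"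
    "xs = trace g p" "e = (g \<otimes> val p, a)" "ys = trace (g \<otimes> val p \<otimes> lv a) q"
proof -
  define p a q where "p = map snd xs" and "a = snd e" and "q = map snd ys"
  have u: "u = p @ a # q"
    using arg_cong[OF assms(1), of "map snd"] by (simp add: p_def a_def q_def)
  then have w: "p \<in> words X" "a \<in> letters X" "q \<in> words X"
    using assms(3) by auto
  have "trace g p @ (g \<otimes> val p, a) # trace (g \<otimes> val p \<otimes> lv a) q = xs @ e # ys"
    using assms w by (simp add: u)
  moreover have "length (trace g p) = length xs"
    by (simp add: p_def)
  ultimately show thesis
    using u w that by (auto simp: append_eq_append_conv)
qed

text \<open>A path is determined by its start and its label. This allows all later arguments to work
  with words read from a vertex by \<open>trace\<close>.\<close>

lemma path_iff:
  "path X G \<iota> g p h \<longleftrightarrow>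
    g \<in> carrier G \<and> map snd p \<in> words X \<and> p = trace g (map snd p) \<and> h = g \<otimes> val (map snd p)"
proof (induction p arbitrary: g)
  case Nil
  then show ?case by auto
next
  case (Cons e p)
  obtain k a where e: "e = (k, a)" by (cases e)
  show ?case
    using Cons[of "g \<otimes> lv a"] by (auto simp: e cay_edges_def tgt_def m_assoc)
qed

lemma path_trace: "g \<in> carrier G \<Longrightarrow> u \<in> words X \<Longrightarrow> path X G \<iota> g (trace g u) (g \<otimes> val u)"
  by (simp add: path_iff)

text \<open>The kernel of evaluation, unfolded from the two-step quotient \<open>Gp\<close> to the
  words. The given isomorphism is prescribed on positive letters only; on negative letters its value
  is forced by cancellation.\<close>

lemma group_presented_val_eq_iff:
  assumes pres: "group_presented_by X G \<iota> R" and uv: "u \<in> words X" "v \<in> words X"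
  shows "val u = val v \<longleftrightarrow>
    (u, v) \<in> cong_gen (word_monoid X) ({([a, linv a], []) | a. a \<in> letters X} \<union> {(r, []) | r. r \<in> R})"
proof -
  let ?S = "{([a, linv a], []) | a. a \<in> letters X}" and ?T = "{(r, []) | r. r \<in> R}"
  interpret W: monoid "word_monoid X" by (rule monoid_word_monoid)
  have RX: "R \<subseteq> words X" using pres by (simp add: group_presented_by_def)
  then have T: "?T \<subseteq> carrier (word_monoid X) \<times> carrier (word_monoid X)" by auto
  have Q: "free_group X = quot_monoid (word_monoid X) (cong_gen (word_monoid X) ?S)"
    by (simp add: free_group_def free_group_cong_def)
  have cong: "Gp_cong X R = cong_gen (free_group X)
      {(cong_gen (word_monoid X) ?S `` {u}, cong_gen (word_monoid X) ?S `` {v}) | u v. (u, v) \<in> ?T}"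
    unfolding Gp_cong_def free_group_cong_def Q W.quot_one
    by (rule arg_cong[of _ _ "cong_gen _"]) auto
  have cls: "Gp_class X R = (\<lambda>u. Gp_cong X R `` {cong_gen (word_monoid X) ?S `` {u}})"
    by (simp add: Gp_class_def free_group_cong_def fun_eq_iff)
  have cls_eq: "Gp_class X R u = Gp_class X R v \<longleftrightarrow> (u, v) \<in> cong_gen (word_monoid X) (?S \<union> ?T)"
    unfolding cls cong Q using uv by (intro W.quot_quot_class_eq_iff T) simp_all
  have hom: "Gp_class X R \<in> hom (word_monoid X) (Gp X R)"
    unfolding cls Gp_def cong Q by (rule W.quot_quot_class_hom)
  have surj: "Gp_class X R ` words X = carrier (Gp X R)"
    unfolding cls Gp_def cong Q using W.quot_quot_class_surj by simp
  obtain \<phi> where \<phi>: "\<phi> \<in> iso (Gp X R) G" "\<And>x. x \<in> X \<Longrightarrow> \<phi> (Gp_class X R [(x, True)]) = \<iota> x"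
    using pres by (auto simp: group_presented_by_def)
  define \<psi> where "\<psi> = \<phi> \<circ> Gp_class X R"
  have \<psi>: "\<psi> \<in> hom (word_monoid X) G"
    unfolding \<psi>_def using Group.hom_compose[OF hom, of \<phi> G] \<phi>(1) by (simp add: iso_def)
  have \<psi>_closed: "\<psi> u \<in> carrier G" if "u \<in> words X" for u
    using hom_in_carrier[OF \<psi>] that by simp
  have \<psi>_append: "\<psi> (u @ v) = \<psi> u \<otimes> \<psi> v" if "u \<in> words X" "v \<in> words X" for u v
    using hom_mult[OF \<psi>] that by simp
  have \<psi>_cong: "\<psi> u = \<psi> v" if "(u, v) \<in> ?S" for u v
  proof -
    have "(u, v) \<in> cong_gen (word_monoid X) (?S \<union> ?T)"
      using that by (auto intro!: cong_gen.base)
    then have "Gp_class X R u = Gp_class X R v"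
      unfolding cls cong Q using that by (subst W.quot_quot_class_eq_iff[OF _ _ T]) auto
    then show ?thesis by (simp add: \<psi>_def)
  qed
  have \<psi>_Nil: "\<psi> [] = \<one>"
    using \<psi>_append[of "[]" "[]"] \<psi>_closed[of "[]"] by simp
  have \<psi>_letter: "\<psi> [a] = lv a" if a: "a \<in> letters X" for a
  proof (cases a)
    case (Pair x b)
    have x: "x \<in> X" using a Pair by (simp add: letters_def)
    have pos: "\<psi> [(x, True)] = \<iota> x" using \<phi>(2)[OF x] by (simp add: \<psi>_def)
    show ?thesis
    proof (cases b)
      case False
      have "([(x, False), linv (x, False)], []) \<in> ?S"
        using a Pair False by auto
      then have "\<psi> [(x, False)] \<otimes> \<psi> [(x, True)] = \<one>"
        using \<psi>_cong \<psi>_append[of "[(x, False)]" "[(x, True)]"] \<psi>_Nil x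
        by (simp add: letters_def linv_def)
      then have "\<psi> [(x, False)] = inv (\<iota> x)"
        using \<psi>_closed[of "[(x, False)]"] \<psi>_closed[of "[(x, True)]"] x
        by (simp add: pos inv_equality letters_def)
      then show ?thesis by (simp add: Pair False letter_val_def)
    qed (simp add: Pair letter_val_def pos)
  qed
  have val: "\<psi> u = val u" if "u \<in> words X" for u
    using that
  proof (induction u)
    case (Cons a u)
    then show ?case
      using \<psi>_append[of "[a]" u] by (simp add: \<psi>_letter)
  qed (simp add: \<psi>_Nil)
  have "val u = val v \<longleftrightarrow> Gp_class X R u = Gp_class X R v"
    using \<phi>(1) uv imageI[of _ "words X" "Gp_class X R"]
    by (auto simp: iso_def bij_betw_def surj \<psi>_def simp flip: val dest: inj_onD)
  then show ?thesis using cls_eq by simp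
qed

end

section \<open>Blocks of the Cayley graph\<close>

text \<open>The length condition makes every non-empty relator divisible into two non-empty parts,
  so that it imposes a relation u = v^-1, and gives each of its letters a neighbour at another
  position of the cycle.\<close>

locale cayley_presentation = cayley G X \<iota>
  for G :: "('g, 'b) monoid_scheme" (structure) and X :: "'x set" and \<iota> :: "'x \<Rightarrow> 'g" +
  fixes R :: "'x word set"
  assumes relators: "r \<in> R \<Longrightarrow> r \<in> words X"
    and relator_length: "r \<in> R \<Longrightarrow> length r \<noteq> 1"
    and val_eq_iff: "u \<in> words X \<Longrightarrow> v \<in> words X \<Longrightarrow> val u = val v \<longleftrightarrow>
      (u, v) \<in> cong_gen (word_monoid X) ({([a, linv a], []) | a. a \<in> letters X} \<union> {(r, []) | r. r \<in> R})"
begin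

text \<open>Multiplication of two congruent pairs is split into multiplication by a fixed word on
  either side. This suits statements about paths: a factor on the left moves the start vertex, and a
  factor on the right is read from a common vertex because the values agree.\<close>

lemma val_eq_induct [consumes 3, case_names refl sym trans left right cancel relator]:
  assumes "val u = val v" and u: "u \<in> words X" and v: "v \<in> words X"
    and refl: "\<And>u. u \<in> words X \<Longrightarrow> P u u"
    and sym: "\<And>u v. u \<in> words X \<Longrightarrow> v \<in> words X \<Longrightarrow> P u v \<Longrightarrow> P v u"
    and trans: "\<And>u v w. u \<in> words X \<Longrightarrow> v \<in> words X \<Longrightarrow> w \<in> words X \<Longrightarrow>
      P u v \<Longrightarrow> P v w \<Longrightarrow> P u w"
    and left: "\<And>s u v. s \<in> words X \<Longrightarrow> u \<in> words X \<Longrightarrow> v \<in> words X \<Longrightarrow> val u = val v \<Longrightarrow>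
      P u v \<Longrightarrow> P (s @ u) (s @ v)"
    and right: "\<And>s u v. s \<in> words X \<Longrightarrow> u \<in> words X \<Longrightarrow> v \<in> words X \<Longrightarrow> val u = val v \<Longrightarrow>
      P u v \<Longrightarrow> P (u @ s) (v @ s)"
    and cancel: "\<And>a. a \<in> letters X \<Longrightarrow> P [a, linv a] []"
    and relator: "\<And>r. r \<in> R \<Longrightarrow> P r []"
  shows "P u v"
proof -
  let ?C = "cong_gen (word_monoid X) ({([a, linv a], []) | a. a \<in> letters X} \<union> {(r, []) | r. r \<in> R})"
  have C: "u \<in> words X \<and> v \<in> words X \<and> val u = val v" if "(u, v) \<in> ?C" for u v
    using monoid.cong_gen_carrier[OF monoid_word_monoid that] val_eq_iff that by simp
  have "(u, v) \<in> ?C"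
    using assms(1) val_eq_iff[OF u v] by simp
  then show ?thesis
  proof induction
    case (base a b)
    then show ?case using cancel relator by auto
  next
    case (refl a)
    then show ?case using assms(4) by simp
  next
    case (sym a b)
    then show ?case using assms(5) C by blast
  next
    case (trans a b c)
    then show ?case using assms(6) C by blast
  next
    case (mult a b c d)
    note ab = C[OF mult.hyps(1)] and cd = C[OF mult.hyps(2)]
    have "P (a @ c) (b @ c)" "P (b @ c) (b @ d)"
      using right[of c a b] left[of b c d] mult.IH ab cd by simp_all
    then show ?case
      using assms(6)[of "a @ c" "b @ c" "b @ d"] ab cd by simp
  qed
qed

lemma val_relator: "r \<in> R \<Longrightarrow> val r = \<one>"
  using val_eq_iff[of r "[]"] relators by (auto intro: cong_gen.base)

text \<open>A pair in \<open>adj\<close> consists of the two germs of a relator cycle at one of its vertices.  The classes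
  of \<open>blk\<close> play the role of the \<open>2\<close>-connected components of the Cayley graph.\<close>

definition adj :: "('x letter \<times> 'x letter) set"
  where "adj = {(linv b, c) | b c s. \<exists>r\<in>R. cyclic_conjugate (b # c # s) r}"

text \<open>Germs at a vertex are compared by their letters alone: relators can be read from every
  vertex, so the same letters are tied together everywhere.\<close>

definition link :: "('x letter \<times> 'x letter) set"
  where "link = (adj \<union> adj\<inverse>)\<^sup>*"

definition edge_adj :: "(('g, 'x) edge \<times> ('g, 'x) edge) set"
  where "edge_adj = {(e, f). e \<in> E \<and> f \<in> E \<and>
    (f = einv G \<iota> e \<or> fst e = fst f \<and> (snd e, snd f) \<in> link)}"

text \<open>Symmetry is inherited from \<open>edge_adj\<close>. Reflexivity also covers pairs
  outside of \<open>E\<close>, which is why membership in \<open>E\<close> is carried along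
  below.\<close>

definition blk :: "(('g, 'x) edge \<times> ('g, 'x) edge) set"
  where "blk = edge_adj\<^sup>*"

lemma adjI: "r \<in> R \<Longrightarrow> cyclic_conjugate (b # c # s) r \<Longrightarrow> (linv b, c) \<in> adj"
  unfolding adj_def by blast

lemma adj_link: "p \<in> adj \<Longrightarrow> p \<in> link"
  unfolding link_def by blast

lemma link_refl [simp]: "(a, a) \<in> link"
  by (simp add: link_def)

lemma sym_link: "sym link"
  unfolding link_def by (intro sym_rtrancl sym_Un_converse)

lemma link_sym: "(a, b) \<in> link \<Longrightarrow> (b, a) \<in> link"
  using sym_link by (auto dest: symD)

lemma link_trans: "(a, b) \<in> link \<Longrightarrow> (b, c) \<in> link \<Longrightarrow> (a, c) \<in> link"
  by (simp add: link_def)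

lemma sym_edge_adj: "sym edge_adj"
  by (auto simp: sym_def edge_adj_def intro: link_sym)

lemma blk_refl [simp]: "(e, e) \<in> blk"
  by (simp add: blk_def)

lemma blk_sym: "(e, f) \<in> blk \<Longrightarrow> (f, e) \<in> blk"
  using sym_rtrancl[OF sym_edge_adj] by (auto simp: blk_def dest: symD)

lemma blk_trans: "(e, f) \<in> blk \<Longrightarrow> (f, k) \<in> blk \<Longrightarrow> (e, k) \<in> blk"
  by (simp add: blk_def)

lemma blk_einv: "e \<in> E \<Longrightarrow> (e, einv G \<iota> e) \<in> blk"
  by (auto simp: blk_def edge_adj_def)

lemma blk_reverse_germ:
  assumes "(k, c) \<in> blk `` {e}" "(k, c) \<in> E"
  shows "(k \<otimes> lv c, linv c) \<in> blk `` {e}" "(k \<otimes> lv c, linv c) \<in> E"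
  using blk_trans[OF _ blk_einv[OF assms(2)], of e] einv_closed[OF assms(2)] assms(1)
  by (auto simp: einv_def tgt_def)

lemma blk_edges: "(e, f) \<in> blk \<Longrightarrow> e \<in> E \<longleftrightarrow> f \<in> E"
  unfolding blk_def by (induction rule: rtrancl_induct) (auto simp: edge_adj_def)

lemma edge_adj_translate:
  assumes "g \<in> carrier G" "((h, a), (k, b)) \<in> edge_adj"
  shows "((g \<otimes> h, a), (g \<otimes> k, b)) \<in> edge_adj"
  using assms by (auto simp: edge_adj_def cay_edges_def einv_def tgt_def m_assoc)

lemma blk_translate:
  assumes "g \<in> carrier G" "((h, a), (k, b)) \<in> blk"
  shows "((g \<otimes> h, a), (g \<otimes> k, b)) \<in> blk"
  using assms(2) unfolding blk_def
proof (induction rule: rtrancl_induct2)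
  case (step h' a' h'' a'')
  then show ?case
    using edge_adj_translate[OF assms(1)] by (meson rtrancl.rtrancl_into_rtrancl)
qed simp

definition saturated :: "('g, 'x) edge set \<Rightarrow> bool"
  where "saturated K \<longleftrightarrow> edge_adj `` K \<subseteq> K"

lemma saturated_blk: "saturated (blk `` K)"
  unfolding saturated_def blk_def by (blast intro: rtrancl_into_rtrancl)

lemma saturated_iff: "saturated K \<Longrightarrow> (e, f) \<in> edge_adj \<Longrightarrow> e \<in> K \<longleftrightarrow> f \<in> K"
  using symD[OF sym_edge_adj, of e f] unfolding saturated_def by blast

lemma saturated_einv_iff: "saturated K \<Longrightarrow> e \<in> E \<Longrightarrow> einv G \<iota> e \<in> K \<longleftrightarrow> e \<in> K"
  using saturated_iff[of K e "einv G \<iota> e"] by (auto simp: edge_adj_def)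

lemma relator_successively:
  assumes "r \<in> R"
  shows "successively (\<lambda>b c. (linv b, c) \<in> link) r"
proof -
  have "successively (\<lambda>b c. (linv b, c) \<in> link) t" if "r = p @ t" for p t
    using that
  proof (induction t arbitrary: p rule: induct_list012)
    case (3 b c q)
    have "cyclic_conjugate (b # c # q @ p) r"
      unfolding cyclic_conjugate_def 3 by (rule exI[of _ "b # c # q"], rule exI[of _ p]) simp
    then have "(linv b, c) \<in> link"
      using assms by (blast intro: adj_link adjI)
    then show ?case
      using 3(2)[of "p @ [b]"] 3(3) by simp
  qed auto
  from this[of "[]" r] show ?thesis by simp
qed

text \<open>The remaining vertex of the relator cycle, where it closes up. The pair lies in
  \<open>adj\<close> after rotating the last letter to the front, which needs two different
  positions.\<close>

lemma relator_last_hd: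
  assumes "r \<in> R" "r \<noteq> []"
  shows "(linv (last r), hd r) \<in> link"
proof -
  obtain a s where r: "r = a # s" using assms(2) by (cases r) auto
  have "s \<noteq> []" using relator_length[OF assms(1)] by (auto simp: r)
  then have r': "r = a # butlast s @ [last s]" by (simp add: r)
  have "cyclic_conjugate (last s # a # butlast s) r"
    unfolding cyclic_conjugate_def
    by (rule exI[of _ "[last s]"], rule exI[of _ "a # butlast s"]) (simp add: r')
  then have "(linv (last s), a) \<in> link"
    using assms(1) by (blast intro: adj_link adjI)
  then show ?thesis
    using \<open>s \<noteq> []\<close> by (simp add: r)
qed

text \<open>At each inner vertex one passes from an edge to its reverse and from there to a linked
  germ; both are \<open>edge_adj\<close> steps, so membership in \<open>K\<close> propagates along
  the whole path.\<close>

lemma trace_successively_saturated: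
  assumes "saturated K" "successively (\<lambda>b c. (linv b, c) \<in> link) (a # s)"
    "g \<in> carrier G" "a # s \<in> words X" "e \<in> set (trace g (a # s))"
  shows "e \<in> K \<longleftrightarrow> (g, a) \<in> K"
  using assms(2-)
proof (induction s arbitrary: g a)
  case (Cons b s)
  have "((g, a), (g \<otimes> lv a, linv a)) \<in> edge_adj" "((g \<otimes> lv a, linv a), (g \<otimes> lv a, b)) \<in> edge_adj"
    using Cons.prems by (auto simp: edge_adj_def cay_edges_def einv_def tgt_def)
  then have "(g \<otimes> lv a, b) \<in> K \<longleftrightarrow> (g, a) \<in> K"
    using saturated_iff[OF assms(1)] by blast
  then show ?case
    using Cons.IH[of b "g \<otimes> lv a"] Cons.prems by auto
qed auto

text \<open>\<open>\<phi>\<close> weighs germs, that is, edges seen from their start. An edge in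
  \<open>K\<close> contributes the weight of its reverse germ at the far end minus that of its own
  germ; for an indicator this counts arrivals minus departures along \<open>K\<close>.\<close>

definition flow :: "(('g, 'x) edge \<Rightarrow> int) \<Rightarrow> ('g, 'x) edge set \<Rightarrow> 'g \<Rightarrow> 'x word \<Rightarrow> int"
  where "flow \<phi> K g u = (\<Sum>e\<leftarrow>trace g u. if e \<in> K then \<phi> (einv G \<iota> e) - \<phi> e else 0)"

text \<open>The condition that lets contributions cancel at an inner vertex of a relator cycle,
  which is entered and left by linked germs.\<close>

definition link_invariant :: "(('g, 'x) edge \<Rightarrow> int) \<Rightarrow> bool"
  where "link_invariant \<phi> \<longleftrightarrow> (\<forall>g a b. (a, b) \<in> link \<longrightarrow> \<phi> (g, a) = \<phi> (g, b))"

lemma link_invariantD: "link_invariant \<phi> \<Longrightarrow> (a, b) \<in> link \<Longrightarrow> \<phi> (g, a) = \<phi> (g, b)"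
  unfolding link_invariant_def by blast

lemma flow_Nil [simp]: "flow \<phi> K g [] = 0"
  by (simp add: flow_def)

lemma flow_append:
  "g \<in> carrier G \<Longrightarrow> u \<in> words X \<Longrightarrow> v \<in> words X \<Longrightarrow>
    flow \<phi> K g (u @ v) = flow \<phi> K g u + flow \<phi> K (g \<otimes> val u) v"
  by (simp add: flow_def)

lemma flow_eq_0:
  assumes "\<And>e. e \<in> set (trace g u) \<Longrightarrow> e \<in> K \<Longrightarrow> \<phi> (einv G \<iota> e) = \<phi> e"
  shows "flow \<phi> K g u = 0"
  using assms by (induction u arbitrary: g) (auto simp: flow_def)

lemma flow_avoid: "set (trace g u) \<inter> K = {} \<Longrightarrow> flow \<phi> K g u = 0"
  by (rule flow_eq_0) auto

lemma flow_successively: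
  assumes "saturated K" "link_invariant \<phi>" "successively (\<lambda>b c. (linv b, c) \<in> link) (a # s)"
    "g \<in> carrier G" "a # s \<in> words X"
  shows "flow \<phi> K g (a # s) =
    (if (g, a) \<in> K then \<phi> (g \<otimes> val (a # s), linv (last (a # s))) - \<phi> (g, a) else 0)"
  using assms(3-)
proof (induction s arbitrary: g a)
  case Nil
  then show ?case by (simp add: flow_def einv_def tgt_def)
next
  case (Cons b s)
  have "(g \<otimes> lv a, b) \<in> K \<longleftrightarrow> (g, a) \<in> K"
    using trace_successively_saturated[OF assms(1) Cons.prems, of "(g \<otimes> lv a, b)"] by simp
  moreover have "\<phi> (g \<otimes> lv a, linv a) = \<phi> (g \<otimes> lv a, b)"
    using Cons.prems by (intro link_invariantD[OF assms(2)]) simp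
  moreover have "flow \<phi> K g (a # b # s) = flow \<phi> K g [a] + flow \<phi> K (g \<otimes> lv a) (b # s)"
    by (simp add: flow_def)
  ultimately show ?case
    using Cons.IH[of b "g \<otimes> lv a"] Cons.prems
    by (auto simp: flow_def einv_def tgt_def m_assoc)
qed

text \<open>A relator cycle lies entirely inside or outside of \<open>K\<close>, and the flow of a cycle inside
  telescopes to zero.\<close>

lemma flow_eq:
  assumes "val u = val v" "u \<in> words X" "v \<in> words X"
    and K: "saturated K" and \<phi>: "link_invariant \<phi>" and g: "g \<in> carrier G"
  shows "flow \<phi> K g u = flow \<phi> K g v"
proof -
  have "\<forall>g\<in>carrier G. flow \<phi> K g u = flow \<phi> K g v"
    using assms(1-3)
  proof (induction rule: val_eq_induct)
    \<comment> \<open>A saturated \<open>K\<close> contains an edge exactly if it contains the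
      inverse, and the contributions of the two are opposite.\<close>
    case (cancel a)
    have "(g \<otimes> lv a, linv a) \<in> K \<longleftrightarrow> (g, a) \<in> K" if "g \<in> carrier G" for g
      using saturated_einv_iff[OF K, of "(g, a)"] cancel that
      by (auto simp: einv_def tgt_def cay_edges_def)
    then show ?case
      using cancel by (auto simp: flow_def einv_def tgt_def m_assoc)
  next
    case (relator r)
    show ?case
    proof (cases r)
      case (Cons a s)
      have "\<phi> (g, linv (last r)) = \<phi> (g, a)" for g
        using link_invariantD[OF \<phi> relator_last_hd[OF relator]] by (simp add: Cons)
      moreover have "val (a # s) = \<one>"
        using val_relator[OF relator] by (simp add: Cons)
      ultimately show ?thesis
        using flow_successively[OF K \<phi>, of a s] relator_successively[OF relator] relators[OF relator]
        by (simp add: Cons flow_def del: val.simps)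
    qed simp
  qed (auto simp: flow_append)
  then show ?thesis using g by blast
qed

text \<open>The chain of \<open>edge_adj\<close> steps becomes a walk in the block: an inversion
  traverses the edge, and a change to a linked germ is invisible to \<open>\<phi>\<close>. As no
  edge of the walk leaves the block, the flow telescopes, by the same walk for all
  \<open>\<phi>\<close>.\<close>

lemma blk_connected:
  assumes "(e, f) \<in> blk" "e \<in> E"
  shows "\<exists>p\<in>words X. fst f = fst e \<otimes> val p \<and>
    (\<forall>\<phi>. link_invariant \<phi> \<longrightarrow> flow \<phi> (blk `` {e}) (fst e) p = \<phi> f - \<phi> e)"
  using assms(1) unfolding blk_def
proof (induction rule: rtrancl_induct)
  case base
  show ?case
    using assms(2) by (intro bexI[of _ "[]"]) (auto simp: flow_def cay_edges_def)
next
  case (step f k)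
  then obtain p where p: "p \<in> words X" "fst f = fst e \<otimes> val p"
    "\<And>\<phi>. link_invariant \<phi> \<Longrightarrow> flow \<phi> (blk `` {e}) (fst e) p = \<phi> f - \<phi> e"
    by (auto simp: blk_def)
  have ef: "(e, f) \<in> blk" using step by (simp add: blk_def)
  have e: "fst e \<in> carrier G" using assms(2) by (auto simp: cay_edges_def)
  from step(2) consider "k = einv G \<iota> f" | "fst f = fst k" "(snd f, snd k) \<in> link"
    by (auto simp: edge_adj_def)
  then show ?case
  proof cases
    case 1
    have a: "snd f \<in> letters X"
      using step(2) by (auto simp: edge_adj_def cay_edges_def)
    have f: "(fst e \<otimes> val p, snd f) = f"
      using p(2) by (simp add: prod_eq_iff)
    have "flow \<phi> (blk `` {e}) (fst e) (p @ [snd f]) = \<phi> k - \<phi> e" if "link_invariant \<phi>" for \<phi>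
      using p(3)[OF that] flow_append[of "fst e" p "[snd f]"] p(1) a e ef
      by (simp add: 1) (simp add: flow_def f)
    moreover have "fst k = fst e \<otimes> val (p @ [snd f])"
      using p a e by (simp add: 1 tgt_def m_assoc)
    ultimately show ?thesis
      unfolding blk_def[symmetric] using p(1) a by (intro bexI[of _ "p @ [snd f]"]) auto
  next
    case 2
    have "flow \<phi> (blk `` {e}) (fst e) p = \<phi> k - \<phi> e" if "link_invariant \<phi>" for \<phi>
      using p(3)[OF that] link_invariantD[OF that 2(2), of "fst f"] 2(1) by (metis prod.collapse)
    then show ?thesis
      unfolding blk_def[symmetric] using p(1,2) 2(1) by (intro bexI[of _ p]) simp_all
  qed
qed

text \<open>Take for \<open>\<phi>\<close> the indicator of the class of germs of b at g. The walk
  inside the block from one germ to the other is closed, so it has the flow of the empty word; hence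
  the indicator agrees on both germs.\<close>

lemma blk_same_vertex_link:
  assumes "((g, a), (g, b)) \<in> blk" "(g, a) \<in> E"
  shows "(a, b) \<in> link"
proof -
  define \<phi> where "\<phi> = (\<lambda>(h, c). if h = g \<and> (b, c) \<in> link then 1 else 0 :: int)"
  have "(b, c) \<in> link \<longleftrightarrow> (b, c') \<in> link" if "(c, c') \<in> link" for c c'
    using link_trans[OF _ that] link_trans[OF _ link_sym[OF that]] by metis
  then have \<phi>: "link_invariant \<phi>"
    by (simp add: link_invariant_def \<phi>_def)
  obtain p where p: "p \<in> words X" "g \<otimes> val p = g"
    "flow \<phi> (blk `` {(g, a)}) g p = \<phi> (g, b) - \<phi> (g, a)"
    using blk_connected[OF assms] \<phi> unfolding fst_conv by metis
  have "g \<in> carrier G" using assms(2) by (simp add: cay_edges_def)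
  then have "val p = val []" using p by simp
  then have "flow \<phi> (blk `` {(g, a)}) g p = 0"
    using flow_eq[OF _ p(1) words_Nil saturated_blk \<phi> \<open>g \<in> carrier G\<close>] by (simp only: flow_Nil)
  then show ?thesis
    using p(3) by (auto simp: \<phi>_def split: if_splits intro: link_sym)
qed

lemma blk_class_eq: "(e, f) \<in> blk \<Longrightarrow> blk `` {e} = blk `` {f}"
  using blk_trans[of e f] blk_trans[of f e] blk_sym[of e f] by blast

text \<open>Compare t, whose flow is zero, with a walk inside the block between the same endpoints.
  For the indicator of the endpoint h the latter has flow 1 unless g = h.\<close>

lemma val_avoiding_path:
  assumes "(g, a) \<in> blk `` {e}" "(g \<otimes> val t, b) \<in> blk `` {e}" "(g, a) \<in> E" "t \<in> words X"
    and avoid: "set (trace g t) \<inter> blk `` {e} = {}"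
  shows "val t = \<one>"
proof -
  define h where "h = g \<otimes> val t"
  define \<phi> where "\<phi> = (\<lambda>(k, c :: 'x letter). if k = h then 1 else 0 :: int)"
  have \<phi>: "link_invariant \<phi>"
    by (auto simp: link_invariant_def \<phi>_def)
  have K: "blk `` {(g, a)} = blk `` {e}"
    using assms(1) blk_class_eq[of e "(g, a)"] by simp
  have "((g, a), (h, b)) \<in> blk"
    using blk_trans[OF blk_sym[of e "(g, a)"], of "(h, b)"] assms(1,2) unfolding h_def by blast
  from blk_connected[OF this assms(3)] obtain p where p: "p \<in> words X" "h = g \<otimes> val p"
    "flow \<phi> (blk `` {e}) g p = \<phi> (h, b) - \<phi> (g, a)"
    using \<phi> by (auto simp: K)
  have g: "g \<in> carrier G" using assms(3) by (simp add: cay_edges_def)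
  then have "val p = val t" using p assms(4) by (simp add: h_def)
  then have "flow \<phi> (blk `` {e}) g p = 0"
    using flow_eq[OF _ p(1) assms(4) saturated_blk \<phi> g] flow_avoid[OF avoid] by simp
  then have "g = h" using p(3) by (auto simp: \<phi>_def split: if_splits)
  then show ?thesis using g assms(4) by (simp add: h_def)
qed

text \<open>Let f be the edge by which p enters the block of e for the first time. As p is simple,
  it never returns to the start \<open>val s\<close> of f. For the indicator of this vertex the flow
  of p is therefore -1, a single departure, while a path avoiding the block has flow 0.\<close>

lemma simple_paths_same_blocks:
  assumes p: "p \<in> words X" "distinct (\<one> # map (tgt G \<iota>) (trace \<one> p))"
    and q: "q \<in> words X" and eq: "val p = val q" and e: "e \<in> set (trace \<one> p)"
  shows "\<exists>f\<in>set (trace \<one> q). (e, f) \<in> blk"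
proof (rule ccontr)
  define K where "K = blk `` {e}"
  assume "\<not> ?thesis"
  then have avoid: "set (trace \<one> q) \<inter> K = {}" by (auto simp: K_def)
  have "\<exists>x\<in>set (trace \<one> p). x \<in> K" using e by (intro bexI[of _ e]) (simp_all add: K_def)
  then obtain xs f ys where split: "trace \<one> p = xs @ f # ys" "f \<in> K" "\<forall>x\<in>set xs. x \<notin> K"
    by (rule split_list_first_propE)
  then obtain s a t where s: "p = s @ a # t" "s \<in> words X" "a \<in> letters X" "t \<in> words X"
    "xs = trace \<one> s" "f = (val s, a)" "ys = trace (val s \<otimes> lv a) t"
    using p(1) by (auto elim!: trace_splitE)
  define \<phi> where "\<phi> = (\<lambda>(k, c :: 'x letter). if k = val s then 1 else 0 :: int)"
  have \<phi>: "link_invariant \<phi>"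
    by (auto simp: link_invariant_def \<phi>_def)
  have last: "val s \<in> insert \<one> (tgt G \<iota> ` set xs)"
  proof (cases s rule: rev_cases)
    case (snoc s' b)
    then show ?thesis
      using s(2) by (auto simp: s(5) tgt_def image_Un)
  qed simp
  have notin: "val s \<notin> tgt G \<iota> ` set (f # ys)"
  proof -
    have "distinct ((\<one> # map (tgt G \<iota>) xs) @ map (tgt G \<iota>) (f # ys))"
      using p(2) by (simp add: split(1))
    then have "set (\<one> # map (tgt G \<iota>) xs) \<inter> set (map (tgt G \<iota>) (f # ys)) = {}"
      by (simp only: distinct_append)
    then show ?thesis
      using last unfolding list.set set_map by blast
  qed
  have out: "fst k \<noteq> val s \<and> tgt G \<iota> k \<noteq> val s" if "k \<in> set ys" for k
  proof -
    have "fst k \<in> insert (tgt G \<iota> f) (tgt G \<iota> ` set ys)"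
      using trace_fst[of k "tgt G \<iota> f" t] that unfolding s(7) by (simp add: s(6) tgt_def)
    then show ?thesis
      using notin imageI[OF that, of "tgt G \<iota>"] by auto
  qed
  have "flow \<phi> K (val s \<otimes> lv a) t = 0"
  proof (rule flow_eq_0)
    fix k assume "k \<in> set (trace (val s \<otimes> lv a) t)"
    then show "\<phi> (einv G \<iota> k) = \<phi> k"
      using out[of k] by (simp add: s(7) \<phi>_def split_def)
  qed
  moreover have "flow \<phi> K \<one> s = 0"
    using split(3) by (intro flow_avoid) (auto simp: s(5))
  \<comment> \<open>The set in \<open>notin\<close> includes the target of f, so f is not a loop and
    no arrival offsets the departure.\<close>
  moreover have "flow \<phi> K (val s) [a] = - 1"
    using split(2) notin by (auto simp: flow_def \<phi>_def split_def s(6))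
  ultimately have "flow \<phi> K \<one> p = - 1"
    using flow_append[of \<one> s "a # t" \<phi> K] flow_append[of "val s" "[a]" t \<phi> K] s(1-4) by simp
  moreover have "flow \<phi> K \<one> p = 0"
    using flow_eq[OF eq p(1) q saturated_blk \<phi> one_closed] flow_avoid[OF avoid]
    by (simp add: K_def)
  ultimately show False by simp
qed

end

section \<open>Words in the presented inverse monoid\<close>

locale presented_words = cayley_presentation G X \<iota> R + wagner_congruence eqv
  for G :: "('g, 'b) monoid_scheme" (structure) and X :: "'x set" and \<iota> :: "'x \<Rightarrow> 'g"
    and R :: "'x word set" and eqv :: "'x word \<Rightarrow> 'x word \<Rightarrow> bool" (infix "\<approx>" 50) +
  assumes relation: "r \<in> R \<Longrightarrow> cyclic_conjugate (u @ v) r \<Longrightarrow> u \<noteq> [] \<Longrightarrow> v \<noteq> [] \<Longrightarrow> u \<approx> winv v"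
begin

text \<open>From a relator \<open>b c s\<close> and its rotation \<open>c s b\<close>: c equals b^-1
  s^-1 and b^-1 equals c s, so each of the two germs is a prefix of a word equal to the
  other.\<close>

lemma adj_absorbs:
  assumes "(a, c) \<in> adj"
  shows "absorbs [a] [c] \<and> absorbs [c] [a]"
proof -
  obtain b s r where b: "a = linv b" "r \<in> R" "cyclic_conjugate (b # c # s) r"
    using assms unfolding adj_def by blast
  then have "cyclic_conjugate (c # s @ [b]) r"
    using cyclic_conjugate_rotate[of "[b]" "c # s"] by simp
  then have "[c] \<approx> winv (s @ [b])"
    using relation[OF b(2), of "[c]" "s @ [b]"] by simp
  then have "absorbs [c] [linv b]"
    using absorbs_cong[OF absorbs_prefix[of "[linv b]" "winv s"] eqv_sym eqv_refl] by simp
  moreover have "[b] \<approx> winv (c # s)"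
    using relation[OF b(2), of "[b]" "c # s"] b(3) by simp
  then have "[linv b] \<approx> c # s"
    using winv_cong[of "[b]" "winv (c # s)"] by simp
  then have "absorbs [linv b] [c]"
    using absorbs_cong[OF absorbs_prefix[of "[c]" s] eqv_sym eqv_refl] by simp
  ultimately show ?thesis
    by (simp add: b(1))
qed

lemma link_absorbs:
  assumes "(a, b) \<in> link"
  shows "absorbs [a] [b]"
  using assms unfolding link_def
proof (induction rule: rtrancl_induct)
  case base
  show ?case by (rule absorbs_refl)
next
  case (step b c)
  then show ?case
    using adj_absorbs[of b c] adj_absorbs[of c b] absorbs_trans by auto
qed

lemma blk_absorbs: "((g, a), (g, b)) \<in> blk \<Longrightarrow> (g, a) \<in> E \<Longrightarrow> absorbs [a] [b]"
  by (rule link_absorbs[OF blk_same_vertex_link])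

text \<open>The dual form: upon arrival along a, whose germ at the far end is \<open>linv a\<close>,
  a detour over b is free.\<close>

lemma absorbs_linv:
  assumes "absorbs [linv a] [b]"
  shows "[a, b, linv b] \<approx> [a]"
  using winv_cong[of "[b] @ winv [b] @ [linv a]" "[linv a]"] assms by (simp add: absorbs_def)

text \<open>The labels are joined without regard to gaps. If \<open>K\<close> is a block, an
  excursion that leaves and re-enters it returns to its starting point by
  \<open>val_avoiding_path\<close>, so the pieces fit together.\<close>

definition kept :: "('g, 'x) edge set \<Rightarrow> 'g \<Rightarrow> 'x word \<Rightarrow> 'x word"
  where "kept K g u = map snd (filter (\<lambda>e. e \<in> K) (trace g u))"

lemma kept_append [simp]:
  "g \<in> carrier G \<Longrightarrow> u \<in> words X \<Longrightarrow> v \<in> words X \<Longrightarrow>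
    kept K g (u @ v) = kept K g u @ kept K (g \<otimes> val u) v"
  by (simp add: kept_def)

lemma kept_Nil [simp]: "kept K g [] = []"
  by (simp add: kept_def)

lemma kept_subset: "set (trace g u) \<subseteq> K \<Longrightarrow> kept K g u = u"
  by (simp add: kept_def filter_id_conv[THEN iffD2] subset_eq)

lemma kept_avoid: "set (trace g u) \<inter> K = {} \<Longrightarrow> kept K g u = []"
  by (auto simp: kept_def filter_empty_conv)

text \<open>Quantifying over all continuations \<open>s\<close> makes the notion stable under extending the path, also while
  the path is away from \<open>K\<close>.\<close>

definition supports :: "('g, 'x) edge set \<Rightarrow> 'g \<Rightarrow> 'x word \<Rightarrow> bool"
  where "supports K g d \<longleftrightarrow> (\<forall>s b. s \<in> words X \<longrightarrow> (g \<otimes> val s, b) \<in> K \<longrightarrow>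
    d @ kept K g s @ [b, linv b] \<approx> d @ kept K g s)"

lemma supports_shift:
  assumes "supports K g d" "g \<in> carrier G" "s \<in> words X"
  shows "supports K (g \<otimes> val s) (d @ kept K g s)"
  unfolding supports_def
proof (intro allI impI)
  fix t b assume t: "t \<in> words X" "(g \<otimes> val s \<otimes> val t, b) \<in> K"
  then have "d @ kept K g (s @ t) @ [b, linv b] \<approx> d @ kept K g (s @ t)"
    using assms by (intro assms(1)[unfolded supports_def, rule_format]) (auto simp: m_assoc)
  then show "(d @ kept K g s) @ kept K (g \<otimes> val s) t @ [b, linv b] \<approx>
      (d @ kept K g s) @ kept K (g \<otimes> val s) t"
    using assms t by simp
qed

text \<open>Deleting the edges outside of \<open>K\<close> turns the elementary steps of the group presentation into
  steps that are absorbed by any supporting word.\<close>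

lemma kept_eqv:
  assumes "val u = val v" "u \<in> words X" "v \<in> words X"
    and K: "saturated K" and g: "g \<in> carrier G" and d: "supports K g d"
  shows "d @ kept K g u \<approx> d @ kept K g v"
proof -
  \<comment> \<open>The vertex and the supporting word stay quantified because the case
    \<open>left\<close> moves a prefix into d and shifts the vertex.\<close>
  have "\<forall>g d. g \<in> carrier G \<longrightarrow> supports K g d \<longrightarrow> d @ kept K g u \<approx> d @ kept K g v"
    using assms(1-3)
  proof (induction rule: val_eq_induct)
    case (sym u v)
    then show ?case by (meson eqv_sym)
  next
    case (trans u v w)
    then show ?case by (meson eqv_trans)
  next
    case (left s u v)
    show ?case
    proof (intro allI impI)
      fix g d assume g: "g \<in> carrier G" and d: "supports K g d"
      have "(d @ kept K g s) @ kept K (g \<otimes> val s) u \<approx> (d @ kept K g s) @ kept K (g \<otimes> val s) v"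
        using left supports_shift[OF d g left(1)] g m_closed[OF g val_closed[OF left(1)]] by blast
      then show "d @ kept K g (s @ u) \<approx> d @ kept K g (s @ v)"
        using left g by simp
    qed
  next
    case (right s u v)
    show ?case
    proof (intro allI impI)
      fix g d assume g: "g \<in> carrier G" and d: "supports K g d"
      have "d @ kept K g u \<approx> d @ kept K g v"
        using right(5) g d by blast
      then have "(d @ kept K g u) @ kept K (g \<otimes> val u) s \<approx> (d @ kept K g v) @ kept K (g \<otimes> val u) s"
        by (rule append[OF _ eqv_refl])
      \<comment> \<open>Both tails are filtered along the same path, as u and v end at the same
        vertex.\<close>
      then show "d @ kept K g (u @ s) \<approx> d @ kept K g (v @ s)"
        using right g by simp
    qed
  next
    case (cancel a)
    show ?case
    proof (intro allI impI)
      fix g d assume g: "g \<in> carrier G" and d: "supports K g d"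
      have "(g \<otimes> lv a, linv a) \<in> K \<longleftrightarrow> (g, a) \<in> K"
        using saturated_einv_iff[OF K, of "(g, a)"] cancel g
        by (auto simp: einv_def tgt_def cay_edges_def)
      moreover have "d @ [a, linv a] \<approx> d" if "(g, a) \<in> K"
        using d[unfolded supports_def, rule_format, of "[]" a] that g by simp
      ultimately show "d @ kept K g [a, linv a] \<approx> d @ kept K g []"
        by (simp add: kept_def)
    qed
  next
    case (relator r)
    show ?case
    proof (cases r)
      case (Cons a s)
      have rX: "r \<in> words X" by (rule relators[OF relator])
      have "s \<noteq> []" using relator_length[OF relator] by (auto simp: Cons)
      have "cyclic_conjugate ([a] @ s) r"
        unfolding cyclic_conjugate_def Cons by (rule exI[of _ "a # s"], rule exI[of _ "[]"]) simp
      from relation[OF relator this] have "[a] \<approx> winv s"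
        using \<open>s \<noteq> []\<close> by simp
      then have "s \<approx> [linv a]"
        using winv_cong[of "[a]" "winv s"] eqv_sym by simp
      \<comment> \<open>A full relator cycle collapses to the idempotent of its first edge, which a
        supporting word absorbs.\<close>
      then have r: "r \<approx> [a, linv a]"
        using append[of "[a]" "[a]" s "[linv a]"] by (simp add: Cons)
      show ?thesis
      proof (intro allI impI)
        fix g d assume g: "g \<in> carrier G" and d: "supports K g d"
        have all: "e \<in> K \<longleftrightarrow> (g, a) \<in> K" if "e \<in> set (trace g r)" for e
          using trace_successively_saturated[OF K, of a s g e] relator_successively[OF relator] that rX g
          by (simp add: Cons)
        show "d @ kept K g r \<approx> d @ kept K g []"
        proof (cases "(g, a) \<in> K")
          case True
          then have "kept K g r = r" using all by (intro kept_subset) auto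
          moreover have "d @ r \<approx> d @ [a, linv a]" by (rule append[OF eqv_refl r])
          moreover have "d @ [a, linv a] \<approx> d"
            using d[unfolded supports_def, rule_format, of "[]" a] True g by simp
          ultimately show ?thesis using eqv_trans by simp
        next
          case False
          then have "kept K g r = []" using all by (intro kept_avoid) auto
          then show ?thesis by simp
        qed
      qed
    qed simp
  qed simp
  then show ?thesis using g d by blast
qed

text \<open>Consider the last edge of s in the block, with label c and end h. The rest of s avoids
  the block, so it is closed by \<open>val_avoiding_path\<close>; hence b and \<open>linv c\<close>
  are germs of the block at h, thus linked, and the detour over b is absorbed after c. If s has no
  such edge, s itself is closed, and the final letter of \<open>[a, linv a]\<close> plays the part
  of c.\<close>

lemma supports_start:
  assumes ga: "(g, a) \<in> E"
  shows "supports (blk `` {(g, a)}) g [a, linv a]"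
  unfolding supports_def
proof (intro allI impI)
  define K where "K = blk `` {(g, a)}"
  fix s b assume s: "s \<in> words X" and b: "(g \<otimes> val s, b) \<in> blk `` {(g, a)}"
  have g: "g \<in> carrier G" using ga by (simp add: cay_edges_def)
  show "[a, linv a] @ kept (blk `` {(g, a)}) g s @ [b, linv b] \<approx>
      [a, linv a] @ kept (blk `` {(g, a)}) g s"
    unfolding K_def[symmetric]
  proof (cases "\<exists>e\<in>set (trace g s). e \<in> K")
    case False
    then have avoid: "set (trace g s) \<inter> K = {}" by blast
    have "val s = \<one>"
      using val_avoiding_path[of g a "(g, a)" s b] b ga s avoid by (simp add: K_def)
    then have "absorbs [a] [b]"
      using blk_absorbs[OF _ ga] b g by simp
    moreover have "absorbs [linv (linv a)] [b]"
      using calculation by simp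
    ultimately show "[a, linv a] @ kept K g s @ [b, linv b] \<approx> [a, linv a] @ kept K g s"
      using append[OF eqv_refl absorbs_linv, of "linv a" b "[a]"] kept_avoid[OF avoid] by simp
  next
    case True
    then obtain xs e ys where split: "trace g s = xs @ e # ys" "e \<in> K" "\<forall>y\<in>set ys. y \<notin> K"
      by (rule split_list_last_propE)
    obtain p c q where p: "s = p @ c # q" "p \<in> words X" "c \<in> letters X" "q \<in> words X"
      "xs = trace g p" "e = (g \<otimes> val p, c)" "ys = trace (g \<otimes> val p \<otimes> lv c) q"
      using trace_splitE[OF split(1) g s] by metis
    define h where "h = g \<otimes> val p \<otimes> lv c"
    have avoid: "set (trace h q) \<inter> K = {}"
      using split(3) by (auto simp: p(7) h_def)
    have kept: "kept K g s = kept K g p @ [c]"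
      using split p(1-6) kept_avoid[OF avoid] g by (simp add: kept_def h_def)
    have "e \<in> E" using p g by (simp add: cay_edges_def)
    then have hK: "(h, linv c) \<in> K" and hE: "(h, linv c) \<in> E"
      using blk_reverse_germ[of "g \<otimes> val p" c] split(2) by (simp_all add: K_def p(6) h_def)
    have hq: "h \<otimes> val q = g \<otimes> val s"
      using p g by (simp add: h_def m_assoc)
    have "val q = \<one>"
      using val_avoiding_path[of h "linv c" "(g, a)" q b] hK hE hq b p(4) avoid by (simp add: K_def)
    then have "(h, b) \<in> K"
      using b hq hE by (simp add: K_def cay_edges_def)
    then have "((h, linv c), (h, b)) \<in> blk"
      using hK blk_trans[OF blk_sym[of "(g, a)" "(h, linv c)"], of "(h, b)"] unfolding K_def by blast
    then have "[c, b, linv b] \<approx> [c]"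
      by (intro absorbs_linv blk_absorbs[OF _ hE])
    then show "[a, linv a] @ kept K g s @ [b, linv b] \<approx> [a, linv a] @ kept K g s"
      using append[OF eqv_refl[of "[a, linv a] @ kept K g p"]] by (simp add: kept)
  qed
qed

text \<open>Nothing is deleted from a path inside the block, so comparison with the empty word shows
  a a^-1 (a p) = a a^-1. The left side is a p, hence a p is the idempotent of its first
  edge.\<close>

lemma closed_in_block_idempotent:
  assumes "a # p \<in> words X" "val (a # p) = \<one>" "g \<in> carrier G"
    and "set (trace g (a # p)) \<subseteq> blk `` {(g, a)}"
  shows "(a # p) @ (a # p) \<approx> a # p"
proof -
  have E: "(g, a) \<in> E" using assms by (simp add: cay_edges_def)
  have "[a, linv a] @ kept (blk `` {(g, a)}) g (a # p) \<approx> [a, linv a] @ kept (blk `` {(g, a)}) g []"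
    using assms by (intro kept_eqv supports_start saturated_blk E) simp_all
  then have "[a, linv a] @ a # p \<approx> [a, linv a]"
    by (simp only: kept_subset[OF assms(4)] kept_Nil append_Nil2)
  moreover have "[a, linv a] @ a # p \<approx> a # p"
    using append[OF regular[of "[a]"] eqv_refl[of p]] by simp
  ultimately have ap: "a # p \<approx> [a, linv a]"
    using eqv_sym eqv_trans by blast
  have "(a # p) @ (a # p) \<approx> [a, linv a] @ a # p"
    by (rule append[OF ap eqv_refl])
  then show ?thesis
    using \<open>[a, linv a] @ a # p \<approx> a # p\<close> by (rule eqv_trans)
qed

text \<open>Cut r as d z s, where d is the initial part inside the block of the first edge and z the
  excursion up to the next vertex where the block is resumed. Then z is closed, and so is d s. Both
  are shorter than r because d and z are non-empty, and \<open>insert_idempotent\<close> combines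
  them.\<close>

theorem closed_idempotent:
  assumes "r \<in> words X" "val r = \<one>"
  shows "r @ r \<approx> r"
  using assms
proof (induction r rule: length_induct)
  case (1 r)
  show ?case
  proof (cases r)
    case (Cons a r')
    define K where "K = blk `` {(\<one>, a)}"
    have aE: "(\<one>, a) \<in> E" using 1(2) by (simp add: Cons cay_edges_def)
    show ?thesis
    proof (cases "set (trace \<one> r) \<subseteq> K")
      case True
      then show ?thesis
        using closed_in_block_idempotent[of a r' \<one>] 1(2,3) by (simp add: Cons K_def)
    next
      case False
      then have "\<exists>e\<in>set (trace \<one> r). e \<notin> K" by blast
      then obtain xs e ys where split: "trace \<one> r = xs @ e # ys" "e \<notin> K" "\<forall>x\<in>set xs. \<not> x \<notin> K"
        by (rule split_list_first_propE)
      obtain d b q where d: "r = d @ b # q" "d \<in> words X" "b \<in> letters X" "q \<in> words X"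
        "xs = trace \<one> d" "e = (val d, b)"
        using trace_splitE[OF split(1) one_closed 1(2)] by (metis l_one val_closed)
      have "d \<noteq> []"
        using d(1,6) split(2) by (auto simp: Cons K_def)
      then obtain d' c where d': "d = d' @ [c]" by (cases d rule: rev_cases) auto
      define t where "t = b # q"
      have t: "t \<in> words X" "r = d @ t" using d by (simp_all add: t_def)
      have "(val d', c) \<in> K" "(val d', c) \<in> E"
        using split(3) d(2) by (auto simp: d(5) d' cay_edges_def)
      then have germ: "(val d, linv c) \<in> K" "(val d, linv c) \<in> E"
        using blk_reverse_germ[of "val d'" c] d(2) by (simp_all add: K_def d')
      have "\<exists>z s y. t = z @ s \<and> z \<noteq> [] \<and> set (trace (val d) z) \<inter> K = {} \<and> (val d \<otimes> val z, y) \<in> K"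
      proof (cases "\<exists>f\<in>set (trace (val d) t). f \<in> K")
        case True
        then obtain xs' f ys' where split': "trace (val d) t = xs' @ f # ys'" "f \<in> K"
          "\<forall>x\<in>set xs'. x \<notin> K"
          by (rule split_list_first_propE)
        obtain z x s where z: "t = z @ x # s" "xs' = trace (val d) z" "f = (val d \<otimes> val z, x)"
          using trace_splitE[OF split'(1) _ t(1)] d(2) by (metis val_closed)
        have "z \<noteq> []"
          using z split(2) split'(2) d(2) by (auto simp: t_def d(6))
        then show ?thesis
          using z split' by (intro exI[of _ z] exI[of _ "x # s"] exI[of _ x]) auto
      next
        case False
        \<comment> \<open>Without a further edge in \<open>K\<close> the excursion lasts until r
          ends. As r is closed, it ends at a vertex of \<open>K\<close>, witnessed by the germ a at
          the start.\<close>
        have "val d \<otimes> val t = \<one>"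
          using 1(3) t d(2) by simp
        then show ?thesis
          using False by (intro exI[of _ t] exI[of _ "[]"] exI[of _ a]) (auto simp: K_def t_def)
      qed
      then obtain z s y where z: "t = z @ s" "z \<noteq> []" "set (trace (val d) z) \<inter> K = {}"
        "(val d \<otimes> val z, y) \<in> K" by blast
      have zs: "z \<in> words X" "s \<in> words X" using t z(1) by auto
      have vz: "val z = \<one>"
        using val_avoiding_path[of "val d" "linv c" "(\<one>, a)" z y] germ z zs by (simp add: K_def)
      then have "val (d @ s) = \<one>"
        using 1(3) t(2) z(1) zs d(2) by simp
      then have "(d @ s) @ (d @ s) \<approx> d @ s"
        using 1(1) z(1,2) t(2) d(2) zs by (metis append_assoc length_append add_less_cancel_left
          length_greater_0_conv less_add_same_cancel2 words_append)
      moreover have "z @ z \<approx> z"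
        using 1(1) vz zs z(1) t(2) \<open>d \<noteq> []\<close> by simp
      ultimately show ?thesis
        using insert_idempotent[of z d s] by (simp add: t(2) z(1))
    qed
  qed simp
qed

text \<open>The part z of t before its first edge in the block of a is closed by
  \<open>val_avoiding_path\<close>, hence idempotent. So that edge starts at h and its letter b
  absorbs a; the idempotent a a^-1 commutes past z and vanishes in b.\<close>

lemma touching_absorbs:
  assumes ha: "(h, a) \<in> E" and t: "t \<in> words X"
    and f: "f \<in> set (trace h t)" "((h, a), f) \<in> blk"
  shows "absorbs t [a]"
proof -
  define K where "K = blk `` {(h, a)}"
  have h: "h \<in> carrier G" using ha by (simp add: cay_edges_def)
  have "\<exists>x\<in>set (trace h t). x \<in> K" using f by (intro bexI[of _ f]) (simp_all add: K_def)
  then obtain xs e ys where split: "trace h t = xs @ e # ys" "e \<in> K" "\<forall>x\<in>set xs. x \<notin> K"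
    by (rule split_list_first_propE)
  obtain z b q where z: "t = z @ b # q" "z \<in> words X" "xs = trace h z" "e = (h \<otimes> val z, b)"
    using trace_splitE[OF split(1) h t] by metis
  have vz: "val z = \<one>"
    using val_avoiding_path[of h a "(h, a)" z b] split z ha by (auto simp: K_def)
  have zz: "z @ z \<approx> z" by (rule closed_idempotent[OF z(2) vz])
  have "((h, a), (h, b)) \<in> blk"
    using split(2) vz h by (simp add: z(4) K_def)
  then have ab: "((h, b), (h, a)) \<in> blk" "(h, b) \<in> E"
    using blk_sym blk_edges ha by blast+
  have ba: "[a] @ winv [a] @ [b] \<approx> [b]"
    using blk_absorbs[OF ab] by (simp add: absorbs_def)
  have aa: "([a] @ winv [a]) @ ([a] @ winv [a]) \<approx> [a] @ winv [a]"
    using append[OF regular[of "[a]"] eqv_refl[of "winv [a]"]] by simp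
  have "([a] @ winv [a]) @ t \<approx> (z @ ([a] @ winv [a])) @ b # q"
    using append[OF idempotents_commute[OF aa zz] eqv_refl[of "b # q"]] by (simp add: z(1))
  also have "\<dots> \<approx> t"
    using ctxt[OF ba, of z q] by (simp add: z(1))
  finally show ?thesis by (simp add: absorbs_def)
qed

lemma touching_absorbs_word:
  assumes "p \<in> words X" "w \<in> words X"
    and "\<And>e. e \<in> set (trace \<one> p) \<Longrightarrow> \<exists>f\<in>set (trace \<one> w). (e, f) \<in> blk"
  shows "absorbs w p"
  using assms(1,3)
proof (induction p rule: rev_induct)
  case Nil
  show ?case by (simp add: absorbs_def)
next
  case (snoc a p)
  have p: "p \<in> words X" "a \<in> letters X" using snoc.prems by auto
  have IH: "absorbs w p"
    using snoc p by simp
  have "(val p, a) \<in> set (trace \<one> (p @ [a]))" using p by simp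
  then obtain f where f: "f \<in> set (trace \<one> w)" "((val p, a), f) \<in> blk"
    using snoc.prems(2) by blast
  \<comment> \<open>Read from the end of p, this word returns to \<open>\<one>\<close> and continues
    along w, so it meets the block of the edge labelled a. Multiplication by p moves the statement
    back to \<open>\<one>\<close>, where \<open>p @ winv p\<close> disappears by the induction
    hypothesis.\<close>
  have "absorbs (winv p @ w) [a]"
    using f p assms(2) by (intro touching_absorbs[of "val p"]) (auto simp: cay_edges_def)
  then have "absorbs (p @ winv p @ w) (p @ [a])"
    by (rule absorbs_left)
  then show ?case
    by (rule absorbs_cong) (use IH in \<open>simp_all add: absorbs_def\<close>)
qed

theorem eqv_of_same_blocks:
  assumes "u \<in> words X" "v \<in> words X" "val u = val v"
    and "\<And>e. e \<in> set (trace \<one> u) \<Longrightarrow> \<exists>f\<in>set (trace \<one> v). (e, f) \<in> blk"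
    and "\<And>e. e \<in> set (trace \<one> v) \<Longrightarrow> \<exists>f\<in>set (trace \<one> u). (e, f) \<in> blk"
  shows "u \<approx> v"
proof (rule eqv_of_absorbs)
  show "absorbs v u" "absorbs u v"
    using assms by (auto intro!: touching_absorbs_word)
  show "(winv u @ v) @ (winv u @ v) \<approx> winv u @ v"
    using assms by (intro closed_idempotent) simp_all
qed

end

section \<open>The Margolis--Meakin expansion\<close>

context cayley
begin

definition span :: "'g \<Rightarrow> 'x word \<Rightarrow> ('g, 'x) graph"
  where "span g u = spanned G \<iota> g (trace g u)"

fun verts :: "'g \<Rightarrow> 'x word \<Rightarrow> 'g list"
  where
    "verts g [] = [g]"
  | "verts g (a # u) = g # verts (g \<otimes> lv a) u"

lemma verts_eq: "verts g u = g # map (tgt G \<iota>) (trace g u)"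
  by (induction u arbitrary: g) (auto simp: tgt_def)

lemma verts_append_map_fst:
  "g \<in> carrier G \<Longrightarrow> u \<in> words X \<Longrightarrow> verts g u = map fst (trace g u) @ [g \<otimes> val u]"
  by (induction u arbitrary: g) (auto simp: m_assoc)

lemma verts_snoc:
  "g \<in> carrier G \<Longrightarrow> u \<in> words X \<Longrightarrow> a \<in> letters X \<Longrightarrow>
    verts g (u @ [a]) = verts g u @ [g \<otimes> val u \<otimes> lv a]"
  by (induction u arbitrary: g) (auto simp: m_assoc)

lemma verts_winv:
  "g \<in> carrier G \<Longrightarrow> u \<in> words X \<Longrightarrow> verts (g \<otimes> val u) (winv u) = rev (verts g u)"
proof (induction u arbitrary: g)
  case (Cons a u)
  then show ?case
    using Cons.IH[of "g \<otimes> lv a"] verts_snoc[of "g \<otimes> lv a \<otimes> val u" "winv u" "linv a"]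
    by (simp add: m_assoc)
qed simp

lemma verts_translate:
  "h \<in> carrier G \<Longrightarrow> g \<in> carrier G \<Longrightarrow> u \<in> words X \<Longrightarrow>
    verts (h \<otimes> g) u = map ((\<otimes>) h) (verts g u)"
  by (induction u arbitrary: g) (auto simp: m_assoc)

lemma distinct_verts_translate:
  assumes "h \<in> carrier G" "g \<in> carrier G" "u \<in> words X" "distinct (verts (h \<otimes> g) u)"
  shows "distinct (verts g u)"
  using assms verts_translate[OF assms(1-3)] by (simp add: distinct_map)

lemma trace_winv:
  "g \<in> carrier G \<Longrightarrow> u \<in> words X \<Longrightarrow>
    trace (g \<otimes> val u) (winv u) = rev (map (einv G \<iota>) (trace g u))"
proof (induction u arbitrary: g)
  case (Cons a u)
  then show ?case
    using Cons.IH[of "g \<otimes> lv a"] trace_append[of "g \<otimes> lv a \<otimes> val u" "winv u" "[linv a]"]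
    by (simp add: m_assoc einv_def tgt_def)
qed simp

lemma set_verts: "set (verts g u) = insert g (tgt G \<iota> ` set (trace g u))"
  by (simp add: verts_eq)

lemma span_eq: "span g u = (set (verts g u), set (trace g u) \<union> einv G \<iota> ` set (trace g u))"
  by (simp add: span_def spanned_def set_verts)

lemma end_in_verts: "g \<in> carrier G \<Longrightarrow> u \<in> words X \<Longrightarrow> g \<otimes> val u \<in> set (verts g u)"
  by (simp add: verts_append_map_fst)

lemma span_append:
  assumes "g \<in> carrier G" "u \<in> words X" "v \<in> words X"
  shows "span g (u @ v) = graph_union (span g u) (span (g \<otimes> val u) v)"
  using assms end_in_verts[OF assms(1,2)]
  by (auto simp: span_eq set_verts graph_union_def image_Un)

lemma span_winv:
  assumes "g \<in> carrier G" "u \<in> words X"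
  shows "span (g \<otimes> val u) (winv u) = span g u"
proof -
  have "einv G \<iota> ` einv G \<iota> ` set (trace g u) = set (trace g u)"
    using trace_edges[OF assms] by (force simp: image_image)
  then show ?thesis
    using assms by (auto simp: span_eq verts_winv trace_winv)
qed

lemma translate_span:
  assumes "h \<in> carrier G" "g \<in> carrier G" "u \<in> words X"
  shows "translate G h (span g u) = span (h \<otimes> g) u"
proof -
  have "(\<lambda>(k, a). (h \<otimes> k, a)) (einv G \<iota> e) = einv G \<iota> ((\<lambda>(k, a). (h \<otimes> k, a)) e)"
    if "e \<in> set (trace g u)" for e
    using trace_edges[OF assms(2,3)] that assms(1)
    by (cases e) (auto simp: einv_def tgt_def cay_edges_def m_assoc)
  then have "(\<lambda>(k, a). (h \<otimes> k, a)) ` einv G \<iota> ` set (trace g u) =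
      einv G \<iota> ` (\<lambda>(k, a). (h \<otimes> k, a)) ` set (trace g u)"
    by (auto simp: image_image intro!: image_cong)
  then show ?thesis
    by (simp add: translate_def span_eq verts_translate[OF assms] trace_translate[OF assms] image_Un)
qed

lemma vertex_prefix:
  assumes "k \<in> set (verts g u)" "g \<in> carrier G" "u \<in> words X"
  obtains p q where "u = p @ q" "k = g \<otimes> val p"
proof -
  have "\<exists>p q. u = p @ q \<and> k = g \<otimes> val p"
    using assms
  proof (induction u arbitrary: g)
    case (Cons a u)
    show ?case
    proof (cases "k = g")
      case True
      then show ?thesis using Cons.prems by (intro exI[of _ "[]"] exI[of _ "a # u"]) auto
    next
      case False
      then obtain p q where "u = p @ q" "k = g \<otimes> lv a \<otimes> val p"
        using Cons.IH[of "g \<otimes> lv a"] Cons.prems by auto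
      then show ?thesis
        using Cons.prems by (intro exI[of _ "a # p"] exI[of _ q]) (auto simp: m_assoc)
    qed
  qed auto
  then show thesis using that by blast
qed

definition MM_val :: "'x word \<Rightarrow> ('g, 'x) graph \<times> 'g"
  where "MM_val u = (span \<one> u, val u)"

lemma MM_val_append:
  assumes "u \<in> words X" "v \<in> words X"
  shows "MM_val u \<otimes>\<^bsub>MM X G \<iota>\<^esub> MM_val v = MM_val (u @ v)"
  using assms translate_span[of "val u" \<one> v] span_append[of \<one> u v]
  by (simp add: MM_def MM_val_def)

lemma MM_val_Nil: "MM_val [] = \<one>\<^bsub>MM X G \<iota>\<^esub>"
  by (simp add: MM_def MM_val_def span_eq)

lemma MM_val_closed:
  assumes u: "u \<in> words X"
  shows "MM_val u \<in> carrier (MM X G \<iota>)"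
proof -
  have E: "e \<in> E" if "e \<in> set (trace \<one> u)" for e
    using trace_edges[OF one_closed u] that by blast
  have fst: "fst e \<in> set (verts \<one> u)" if "e \<in> set (trace \<one> u)" for e
    using that u by (simp add: verts_append_map_fst)
  have tgt: "tgt G \<iota> e \<in> set (verts \<one> u)" if "e \<in> set (trace \<one> u)" for e
    using that by (simp add: set_verts)
  have "set (verts \<one> u) \<subseteq> carrier G"
    using E tgt_closed by (auto simp: set_verts)
  moreover have "e \<in> E \<and> fst e \<in> set (verts \<one> u) \<and> tgt G \<iota> e \<in> set (verts \<one> u) \<and>
      einv G \<iota> e \<in> set (trace \<one> u) \<union> einv G \<iota> ` set (trace \<one> u)"
    if "e \<in> set (trace \<one> u) \<union> einv G \<iota> ` set (trace \<one> u)" for e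
    using that
  proof
    assume "e \<in> einv G \<iota> ` set (trace \<one> u)"
    then obtain f where f: "e = einv G \<iota> f" "f \<in> set (trace \<one> u)" by blast
    then show ?thesis using E fst tgt by simp
  qed (use E fst tgt in auto)
  ultimately have subg: "subgraph X G \<iota> (span \<one> u)"
    unfolding subgraph_def span_eq by (simp add: subset_eq del: Un_iff)
  have sub: "set (trace \<one> p) \<subseteq> set (trace \<one> u)"
    if "u = p @ q" "p \<in> words X" "q \<in> words X" for p q
    unfolding that(1) using that(2,3) by simp
  have fin: "finite_graph (span \<one> u)"
    by (simp add: finite_graph_def span_eq)
  have con: "connected_graph X G \<iota> (span \<one> u)"
    unfolding connected_graph_def
  proof (intro ballI)
    fix g h assume "g \<in> fst (span \<one> u)" "h \<in> fst (span \<one> u)"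
    then obtain p q p' q' where p: "u = p @ q" "g = \<one> \<otimes> val p" and p': "u = p' @ q'" "h = \<one> \<otimes> val p'"
      unfolding span_eq fst_conv using vertex_prefix u one_closed by metis
    have w: "p \<in> words X" "p' \<in> words X" "q \<in> words X" "q' \<in> words X"
      using u p(1) p'(1) by (metis words_append)+
    have "path X G \<iota> g (trace g (winv p @ p')) h"
      using path_trace[of g "winv p @ p'"] w
      by (simp add: p(2) p'(2) m_assoc[symmetric] del: trace_append)
    moreover have "set (trace g (winv p @ p')) \<subseteq> snd (span \<one> u)"
    proof -
      have "set (trace g (winv p @ p')) = einv G \<iota> ` set (trace \<one> p) \<union> set (trace \<one> p')"
        using w trace_winv[of \<one> p] by (simp add: p(2))
      moreover have "set (trace \<one> p) \<subseteq> set (trace \<one> u)" "set (trace \<one> p') \<subseteq> set (trace \<one> u)"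
        using sub[OF p(1) w(1,3)] sub[OF p'(1) w(2,4)] by blast+
      ultimately show ?thesis by (auto simp: span_eq)
    qed
    ultimately show "\<exists>p. path X G \<iota> g p h \<and> set p \<subseteq> snd (span \<one> u)" by blast
  qed
  show ?thesis
    using subg fin con end_in_verts[OF one_closed u] u by (simp add: MM_def MM_val_def span_eq set_verts)
qed

text \<open>A closed walk at \<open>\<one>\<close> through all edges is built one edge at a time, by
  a detour inside the graph to the edge, along it and back the same way. A path to g is appended at
  the end.\<close>

lemma MM_val_surj:
  assumes "m \<in> carrier (MM X G \<iota>)"
  obtains u where "u \<in> words X" "m = MM_val u"
proof -
  obtain \<Gamma> g where m: "m = (\<Gamma>, g)" by (cases m)
  have sub: "subgraph X G \<iota> \<Gamma>" and fin: "finite (snd \<Gamma>)" and con: "connected_graph X G \<iota> \<Gamma>"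
    and one: "\<one> \<in> fst \<Gamma>" and g: "g \<in> fst \<Gamma>"
    using assms by (auto simp: m MM_def finite_graph_def)
  have edge: "e \<in> E \<and> fst e \<in> fst \<Gamma> \<and> tgt G \<iota> e \<in> fst \<Gamma> \<and> einv G \<iota> e \<in> snd \<Gamma>" if "e \<in> snd \<Gamma>" for e
    using sub that unfolding subgraph_def by blast
  have conn: "\<exists>p\<in>words X. val p = k \<and> set (trace \<one> p) \<subseteq> snd \<Gamma>" if k: "k \<in> fst \<Gamma>" for k
  proof -
    obtain p where p: "path X G \<iota> \<one> p k" "set p \<subseteq> snd \<Gamma>"
      using con one k unfolding connected_graph_def by blast
    then have "map snd p \<in> words X" "p = trace \<one> (map snd p)" "k = \<one> \<otimes> val (map snd p)"
      unfolding path_iff by auto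
    then show ?thesis using p(2) by (intro bexI[of _ "map snd p"]) auto
  qed
  have "\<exists>u\<in>words X. val u = \<one> \<and> F \<subseteq> set (trace \<one> u) \<and> set (trace \<one> u) \<subseteq> snd \<Gamma>"
    if "finite F" "F \<subseteq> snd \<Gamma>" for F
    using that
  proof (induction F rule: finite_induct)
    case empty
    then show ?case by (intro bexI[of _ "[]"]) auto
  next
    case (insert e F)
    then obtain u where u: "u \<in> words X" "val u = \<one>" "F \<subseteq> set (trace \<one> u)" "set (trace \<one> u) \<subseteq> snd \<Gamma>"
      by auto
    have e: "e \<in> snd \<Gamma>" using insert by simp
    obtain p where p: "p \<in> words X" "val p = fst e" "set (trace \<one> p) \<subseteq> snd \<Gamma>"
      using conn edge[OF e] by blast
    define q where "q = p @ [snd e]"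
    have q: "q \<in> words X" "trace \<one> q = trace \<one> p @ [e]"
      using p edge[OF e] by (auto simp: q_def cay_edges_def)
    have "trace \<one> (u @ q @ winv q) = trace \<one> u @ trace \<one> q @ rev (map (einv G \<iota>) (trace \<one> q))"
      using u q trace_winv[of \<one> q] by simp
    moreover have "set (trace \<one> q) \<subseteq> snd \<Gamma>" "einv G \<iota> ` set (trace \<one> q) \<subseteq> snd \<Gamma>"
      using p(3) e edge by (auto simp: q(2))
    ultimately show ?case
      using u q by (intro bexI[of _ "u @ q @ winv q"]) auto
  qed
  then obtain u where u: "u \<in> words X" "val u = \<one>" "set (trace \<one> u) = snd \<Gamma>"
    using fin by (metis order_refl subset_antisym)
  obtain p where p: "p \<in> words X" "val p = g" "set (trace \<one> p) \<subseteq> snd \<Gamma>"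
    using conn[OF g] by blast
  have tr: "set (trace \<one> (u @ p)) = snd \<Gamma>"
    using u p by auto
  have "set (verts \<one> (u @ p)) = fst \<Gamma>"
  proof
    show "set (verts \<one> (u @ p)) \<subseteq> fst \<Gamma>"
      unfolding set_verts tr using one edge by auto
    show "fst \<Gamma> \<subseteq> set (verts \<one> (u @ p))"
    proof
      fix k assume "k \<in> fst \<Gamma>"
      then obtain q where q: "q \<in> words X" "val q = k" "set (trace \<one> q) \<subseteq> snd \<Gamma>"
        using conn by blast
      then show "k \<in> set (verts \<one> (u @ p))"
        using end_in_verts[of \<one> q] unfolding set_verts tr by auto
    qed
  qed
  moreover have "snd \<Gamma> \<union> einv G \<iota> ` snd \<Gamma> = snd \<Gamma>"
    using edge by auto
  ultimately have "MM_val (u @ p) = m"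
    using u p(1) by (simp add: MM_val_def span_eq tr m prod_eq_iff p(2)[symmetric] del: trace_append)
  then show thesis
    using that[of "u @ p"] u p by simp
qed

lemma MM_carrier: "carrier (MM X G \<iota>) = MM_val ` words X"
  using MM_val_closed MM_val_surj by blast

text \<open>The monoid laws are inherited from concatenation along the surjection
  \<open>MM_val\<close>.\<close>

lemma monoid_MM: "monoid (MM X G \<iota>)"
proof (rule monoidI)
  show "m \<otimes>\<^bsub>MM X G \<iota>\<^esub> n \<in> carrier (MM X G \<iota>)"
    if "m \<in> carrier (MM X G \<iota>)" "n \<in> carrier (MM X G \<iota>)" for m n
    using that by (elim MM_val_surj) (simp add: MM_val_append MM_val_closed)
  show "\<one>\<^bsub>MM X G \<iota>\<^esub> \<in> carrier (MM X G \<iota>)"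
    using MM_val_closed[of "[]"] by (simp add: MM_val_Nil)
  show "m \<otimes>\<^bsub>MM X G \<iota>\<^esub> n \<otimes>\<^bsub>MM X G \<iota>\<^esub> k = m \<otimes>\<^bsub>MM X G \<iota>\<^esub> (n \<otimes>\<^bsub>MM X G \<iota>\<^esub> k)"
    if "m \<in> carrier (MM X G \<iota>)" "n \<in> carrier (MM X G \<iota>)" "k \<in> carrier (MM X G \<iota>)" for m n k
    using that by (elim MM_val_surj) (simp add: MM_val_append)
  show "\<one>\<^bsub>MM X G \<iota>\<^esub> \<otimes>\<^bsub>MM X G \<iota>\<^esub> m = m" "m \<otimes>\<^bsub>MM X G \<iota>\<^esub> \<one>\<^bsub>MM X G \<iota>\<^esub> = m"
    if "m \<in> carrier (MM X G \<iota>)" for m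
    using that by (elim MM_val_surj; simp add: MM_val_append flip: MM_val_Nil)+
qed

sublocale MM: monoid "MM X G \<iota>"
  by (rule monoid_MM)

lemma MM_val_regular: "u \<in> words X \<Longrightarrow> MM_val (u @ winv u @ u) = MM_val u"
  using span_append[of \<one> u "winv u @ u"] span_append[of "val u" "winv u" u] span_winv[of \<one> u]
  by (simp add: MM_val_def graph_union_def)

lemma MM_val_commute:
  assumes "u \<in> words X" "v \<in> words X"
  shows "MM_val (u @ winv u @ v @ winv v) = MM_val (v @ winv v @ u @ winv u)"
proof -
  have "span \<one> (u @ winv u) = span \<one> u" if "u \<in> words X" for u
    using that span_append[of \<one> u "winv u"] span_winv[of \<one> u] by (simp add: graph_union_def)
  then show ?thesis
    using assms span_append[of \<one> "u @ winv u" "v @ winv v"] span_append[of \<one> "v @ winv v" "u @ winv u"]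
    by (simp add: MM_val_def graph_union_def Un_commute)
qed

section \<open>The quotient by \<open>xi\<close> as an image of the words\<close>

definition MsF_val :: "'x word \<Rightarrow> (('g, 'x) graph \<times> 'g) set"
  where "MsF_val u = xi X G \<iota> `` {MM_val u}"

lemma MsF_val_hom: "MsF_val \<in> hom (word_monoid X) (MsF X G \<iota>)"
  unfolding MsF_val_def MsF_def xi_def
  by (rule homI) (simp_all add: MM_val_closed MM.quot_mult MM_val_append)

lemma MsF_val_surj: "MsF_val ` words X = carrier (MsF X G \<iota>)"
  unfolding MsF_val_def MsF_def xi_def MM.quot_carrier_image MM_carrier by (simp add: image_image)

lemma MsF_val_eq_iff:
  "u \<in> words X \<Longrightarrow> v \<in> words X \<Longrightarrow> MsF_val u = MsF_val v \<longleftrightarrow> (MM_val u, MM_val v) \<in> xi X G \<iota>"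
  unfolding MsF_val_def xi_def by (rule MM.cong_class_eq_iff) (rule MM_val_closed; assumption)+

lemma MsF_gen_eq: "x \<in> X \<Longrightarrow> MsF_gen X G \<iota> x = MsF_val [(x, True)]"
  using \<iota>_closed
  by (auto simp: MsF_gen_def MsF_val_def MM_gen_def MM_val_def span_def letter_val_def Pi_iff)

lemma simple_path_span_xi:
  assumes "u \<in> words X" "v \<in> words X" "val u = val v"
    and "distinct (verts \<one> u)" "distinct (verts \<one> v)"
  shows "(MM_val u, MM_val v) \<in> xi X G \<iota>"
  unfolding xi_def
proof (rule cong_gen.base)
  have "simple_path X G \<iota> \<one> (trace \<one> u) (val u)" "simple_path X G \<iota> \<one> (trace \<one> v) (val u)"
    using assms path_trace[of \<one> u] path_trace[of \<one> v] by (simp_all add: simple_path_def verts_eq)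
  then show "(MM_val u, MM_val v) \<in> {((spanned G \<iota> \<one> p, g), (spanned G \<iota> \<one> q, g)) | p q g.
      simple_path X G \<iota> \<one> p g \<and> simple_path X G \<iota> \<one> q g}"
    using assms(3) by (auto simp: MM_val_def span_def)
qed (simp_all add: assms MM_val_closed)

text \<open>Rotating the cycle keeps the initial vertices of its edges distinct. Since v is
  non-empty, the end of u is the initial vertex of an edge of v, so it differs from the other
  vertices of u as well. Left translation moves the path to \<open>\<one>\<close>.\<close>

lemma cyclic_word_distinct:
  assumes r: "cyclic_word X G \<iota> r" and uv: "cyclic_conjugate (u @ v) r" and "v \<noteq> []"
  shows "u \<in> words X" "v \<in> words X" "val (u @ v) = \<one>" "distinct (verts \<one> u)"
proof -
  obtain x y where xy: "u @ v = x @ y" "r = y @ x"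
    using uv by (auto simp: cyclic_conjugate_def)
  obtain g p where p: "path X G \<iota> g p g" "distinct (map fst p)" "map snd p = r"
    using r by (auto simp: cyclic_word_def simple_cycle_def)
  have rw: "r \<in> words X" using r by (simp add: cyclic_word_def)
  then have w: "x \<in> words X" "y \<in> words X" by (simp_all add: xy)
  then have "u @ v \<in> words X" by (simp add: xy(1))
  then show uw: "u \<in> words X" and vw: "v \<in> words X" by simp_all
  have g: "g \<in> carrier G" and pt: "p = trace g r" and gr: "g \<otimes> val r = g"
    using p(1,3) unfolding path_iff by auto
  have vr: "val y \<otimes> val x = \<one>"
    using gr g w by (simp add: xy(2) r_cancel_one')
  then have vx: "val x \<otimes> val y = \<one>"
    using w by (metis inv_comm val_closed)
  then show "val (u @ v) = \<one>" using w by (simp add: xy(1))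
  \<comment> \<open>The rotated cycle \<open>x @ y\<close> starts at the vertex reached from g along
    y.\<close>
  define h where "h = g \<otimes> val y"
  have h: "h \<in> carrier G" using g w by (simp add: h_def)
  have hx: "h \<otimes> val x = g" using vr g w by (simp add: h_def m_assoc)
  have "distinct (map fst (trace h (x @ y)))"
    using p(2) w g h hx by (auto simp: pt xy(2) h_def)
  then have "distinct (map fst (trace h (u @ v)))" by (simp only: xy(1))
  moreover obtain b v' where v: "v = b # v'" using \<open>v \<noteq> []\<close> by (cases v) auto
  ultimately have "distinct (verts h u)"
    using h uw vw by (auto simp: verts_append_map_fst)
  then show "distinct (verts \<one> u)"
    using distinct_verts_translate[OF h one_closed uw] h by simp
qed

lemma relation_xi:
  assumes r: "cyclic_word X G \<iota> r" and uv: "cyclic_conjugate (u @ v) r" and ne: "u \<noteq> []" "v \<noteq> []"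
  shows "(MM_val u, MM_val (winv v)) \<in> xi X G \<iota>"
proof -
  note u = cyclic_word_distinct[OF r uv ne(2)]
  note v = cyclic_word_distinct[OF r cyclic_conjugate_rotate[OF uv] ne(1)]
  \<comment> \<open>The rotated relator shows that v is simple from \<open>\<one>\<close>. Its
    reverse is then simple from \<open>val v\<close>, and translation makes it a simple path from
    \<open>\<one>\<close>.\<close>
  have "distinct (verts (val v) (winv v))"
    using verts_winv[of \<one> v] v(1,4) by simp
  then have "distinct (verts \<one> (winv v))"
    using distinct_verts_translate[of "val v" \<one> "winv v"] v(1) by simp
  moreover have "val u = val (winv v)"
    using u(1-3) by (simp add: inv_equality)
  ultimately show ?thesis
    using u v by (intro simple_path_span_xi) simp_all
qed

end

section \<open>The set of blocks met as an invariant of \<open>xi\<close>\<close>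

context cayley_presentation
begin

lemma blk_cover_trans:
  assumes "\<forall>e\<in>A. \<exists>f\<in>B. (e, f) \<in> blk" "\<forall>e\<in>B. \<exists>f\<in>C. (e, f) \<in> blk"
  shows "\<forall>e\<in>A. \<exists>f\<in>C. (e, f) \<in> blk"
proof
  fix e assume "e \<in> A"
  then obtain f where f: "f \<in> B" "(e, f) \<in> blk" using assms(1) by blast
  then obtain k where k: "k \<in> C" "(f, k) \<in> blk" using assms(2) by blast
  show "\<exists>k\<in>C. (e, k) \<in> blk"
    using blk_trans[OF f(2) k(2)] k(1) by (rule bexI)
qed

text \<open>Domination in both directions expresses that the two graphs meet the same blocks. On
  generating pairs this is \<open>simple_paths_same_blocks\<close>; products are covered because
  blocks are permuted by left translation and both second factors are translated by the same
  element.\<close>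

lemma xi_same_blocks:
  assumes "(m, n) \<in> xi X G \<iota>"
  shows "snd m = snd n \<and> (\<forall>e\<in>snd (fst m). \<exists>f\<in>snd (fst n). (e, f) \<in> blk) \<and>
    (\<forall>e\<in>snd (fst n). \<exists>f\<in>snd (fst m). (e, f) \<in> blk)"
  using assms unfolding xi_def
proof induction
  case (base m n)
  then obtain p q g where pq: "m = (spanned G \<iota> \<one> p, g)" "n = (spanned G \<iota> \<one> q, g)"
    "simple_path X G \<iota> \<one> p g" "simple_path X G \<iota> \<one> q g"
    by auto
  define u v where "u = map snd p" and "v = map snd q"
  have u: "u \<in> words X" "p = trace \<one> u" "g = val u" "distinct (\<one> # map (tgt G \<iota>) (trace \<one> u))"
    and v: "v \<in> words X" "q = trace \<one> v" "g = val v" "distinct (\<one> # map (tgt G \<iota>) (trace \<one> v))"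
    using pq(3,4) unfolding simple_path_def path_iff u_def[symmetric] v_def[symmetric] by auto
  have sub: "\<exists>f\<in>snd (spanned G \<iota> \<one> (trace \<one> v)). (e, f) \<in> blk"
    if prems: "u \<in> words X" "distinct (\<one> # map (tgt G \<iota>) (trace \<one> u))" "v \<in> words X" "val u = val v"
      "e \<in> snd (spanned G \<iota> \<one> (trace \<one> u))" for u v e
  proof -
    obtain e' where e': "e' \<in> set (trace \<one> u)" "e = e' \<or> e = einv G \<iota> e'"
      using prems(5) unfolding spanned_def snd_conv by blast
    have "e' \<in> E" using trace_edges[OF one_closed prems(1)] e' by blast
    then have "(e, e') \<in> blk" using e'(2) blk_sym[OF blk_einv, of e'] by auto
    moreover obtain f where "f \<in> set (trace \<one> v)" "(e', f) \<in> blk"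
      using simple_paths_same_blocks[OF prems(1,2,3,4) e'(1)] by blast
    ultimately show ?thesis
      using blk_trans[of e e' f] by (intro bexI[of _ f]) (auto simp: spanned_def)
  qed
  show ?case
    using sub[OF u(1,4) v(1)] sub[OF v(1,4) u(1)] u(3) v(3)
    by (simp add: pq u(2)[symmetric] v(2)[symmetric])
next
  case (refl m)
  then show ?case using blk_refl by blast
next
  case (sym m n)
  then show ?case by simp
next
  case (trans m n k)
  show ?case
  proof (intro conjI)
    show "\<forall>e\<in>snd (fst m). \<exists>f\<in>snd (fst k). (e, f) \<in> blk"
      by (rule blk_cover_trans[of _ "snd (fst n)"]) (use trans.IH in simp_all)
    show "\<forall>e\<in>snd (fst k). \<exists>f\<in>snd (fst m). (e, f) \<in> blk"
      by (rule blk_cover_trans[of _ "snd (fst n)"]) (use trans.IH in simp_all)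
  qed (use trans.IH in simp)
next
  case (mult m n m' n')
  have car: "snd m \<in> carrier G" "snd n \<in> carrier G"
    using mult.hyps(1)[THEN MM.cong_gen_carrier] by (auto simp: MM_def subgraph_def)
  have tr: "\<exists>f\<in>snd (translate G g \<Delta>). (e, f) \<in> blk"
    if prems: "g \<in> carrier G" "\<forall>e\<in>snd \<Gamma>. \<exists>f\<in>snd \<Delta>. (e, f) \<in> blk" "e \<in> snd (translate G g \<Gamma>)" for g \<Gamma> \<Delta> e
  proof -
    obtain h a where ha: "(h, a) \<in> snd \<Gamma>" "e = (g \<otimes> h, a)"
      using prems(3) by (auto simp: translate_def)
    obtain k b where "(k, b) \<in> snd \<Delta>" "((h, a), (k, b)) \<in> blk"
      using prems(2) ha(1) by fast
    then show ?thesis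
      using blk_translate[OF prems(1)] ha(2) by (intro bexI[of _ "(g \<otimes> k, b)"]) (auto simp: translate_def)
  qed
  obtain \<Gamma> g \<Delta> h \<Gamma>' g' \<Delta>' h' where eq: "m = (\<Gamma>, g)" "n = (\<Delta>, h)" "m' = (\<Gamma>', g')" "n' = (\<Delta>', h')"
    by (metis prod.collapse)
  have IH: "g = h" "g' = h'" "\<forall>e\<in>snd \<Gamma>. \<exists>f\<in>snd \<Delta>. (e, f) \<in> blk" "\<forall>e\<in>snd \<Delta>. \<exists>f\<in>snd \<Gamma>. (e, f) \<in> blk"
    "\<forall>e\<in>snd \<Gamma>'. \<exists>f\<in>snd \<Delta>'. (e, f) \<in> blk" "\<forall>e\<in>snd \<Delta>'. \<exists>f\<in>snd \<Gamma>'. (e, f) \<in> blk"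
    using mult.IH by (simp_all add: eq)
  have h: "h \<in> carrier G" using car by (simp add: eq)
  have "\<forall>e\<in>snd \<Gamma> \<union> snd (translate G h \<Gamma>'). \<exists>f\<in>snd \<Delta> \<union> snd (translate G h \<Delta>'). (e, f) \<in> blk"
    "\<forall>e\<in>snd \<Delta> \<union> snd (translate G h \<Delta>'). \<exists>f\<in>snd \<Gamma> \<union> snd (translate G h \<Gamma>'). (e, f) \<in> blk"
    using IH(3,4) tr[OF h IH(5)] tr[OF h IH(6)] by blast+
  then show ?case
    by (simp add: eq MM_def IH(1,2) graph_union_def)
qed

text \<open>Returns from spanned graphs to paths: the inverse edges that the graph adds lie in the
  blocks of the edges traversed.\<close>

lemma MM_val_xi_blocks:
  assumes "(MM_val u, MM_val v) \<in> xi X G \<iota>" "v \<in> words X" "e \<in> set (trace \<one> u)"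
  shows "\<exists>f\<in>set (trace \<one> v). (e, f) \<in> blk"
proof -
  have "e \<in> snd (fst (MM_val u))"
    using assms(3) by (simp add: MM_val_def span_eq)
  then obtain f where "f \<in> snd (fst (MM_val v))" and ef: "(e, f) \<in> blk"
    using xi_same_blocks[OF assms(1)] by blast
  then have f: "f \<in> set (trace \<one> v) \<or> f \<in> einv G \<iota> ` set (trace \<one> v)"
    by (simp add: MM_val_def span_eq)
  from f obtain f' where f': "f' \<in> set (trace \<one> v)" "f = f' \<or> f = einv G \<iota> f'"
    by blast
  have "f' \<in> E" using trace_edges[OF one_closed assms(2)] f' by blast
  then have "(f, f') \<in> blk" using f'(2) blk_sym[OF blk_einv, of f'] by auto
  then show ?thesis
    using f' blk_trans[OF ef] by blast
qed

end

lemma (in presented_words) eqv_of_xi: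
  assumes "u \<in> words X" "v \<in> words X" "(MM_val u, MM_val v) \<in> xi X G \<iota>"
  shows "u \<approx> v"
proof -
  have "(MM_val v, MM_val u) \<in> xi X G \<iota>"
    using assms(3) unfolding xi_def by (rule cong_gen.sym)
  moreover have "val u = val v"
    using xi_same_blocks[OF assms(3)] by (simp add: MM_val_def)
  ultimately show ?thesis
    using assms by (intro eqv_of_same_blocks) (auto intro: MM_val_xi_blocks)
qed

section \<open>The presentation\<close>

theorem theorem4p1:
  fixes G :: "('g, 'b) monoid_scheme"
    and X :: "'x set"
    and \<iota> :: "'x \<Rightarrow> 'g"
    and I :: "'i set"
    and w :: "'i \<Rightarrow> 'x word"
  assumes "generated_group X G \<iota>"
    and "group_presented_by X G \<iota> (w ` I)"
    and "\<And>i. i \<in> I \<Longrightarrow> cyclic_word X G \<iota> (w i)"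
    and "\<And>i. i \<in> I \<Longrightarrow> length (w i) \<noteq> 1"
  shows "inverse_monoid_presented_by X (MsF X G \<iota>) (MsF_gen X G \<iota>)
    {(u, winv v) | u v. u \<in> words X \<and> v \<in> words X \<and> u \<noteq> [] \<and> v \<noteq> [] \<and>
       (\<exists>i\<in>I. cyclic_conjugate (u @ v) (w i))}" (is "inverse_monoid_presented_by _ _ _ ?T")
proof -
  interpret group G using assms(1) by (simp add: generated_group_def)
  interpret cayley G X \<iota>
    using assms(1) by unfold_locales (simp add: generated_group_def)
  interpret cayley_presentation G X \<iota> "w ` I"
    using assms(3,4) group_presented_val_eq_iff[OF assms(2)]
    by unfold_locales (auto simp: cyclic_word_def)
  interpret W: monoid "word_monoid X" by (rule monoid_word_monoid)
  let ?S = "{(u @ winv u @ u, u) | u. u \<in> words X} \<union>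
     {(u @ winv u @ v @ winv v, v @ winv v @ u @ winv u) | u v. u \<in> words X \<and> v \<in> words X}"
  let ?F = "filter (\<lambda>a. a \<in> letters X)"
  \<comment> \<open>The kernel of \<open>Inv_class\<close> on words, with the Wagner relations and
    the relations of the theorem imposed at once.\<close>
  define \<rho> where "\<rho> = cong_gen (word_monoid X) (?S \<union> ?T)"
  have T: "?T \<subseteq> carrier (word_monoid X) \<times> carrier (word_monoid X)" by auto
  have Q: "free_inverse_monoid X = quot_monoid (word_monoid X) (cong_gen (word_monoid X) ?S)"
    by (simp add: free_inverse_monoid_def wagner_cong_def)
  have cong: "Inv_cong X ?T = cong_gen (free_inverse_monoid X)
      {(cong_gen (word_monoid X) ?S `` {u}, cong_gen (word_monoid X) ?S `` {v}) | u v. (u, v) \<in> ?T}"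
    by (simp add: Inv_cong_def wagner_cong_def)
  have cls: "Inv_class X ?T = (\<lambda>u. Inv_cong X ?T `` {cong_gen (word_monoid X) ?S `` {u}})"
    by (simp add: Inv_class_def wagner_cong_def fun_eq_iff)
  have cls_eq: "Inv_class X ?T u = Inv_class X ?T v \<longleftrightarrow> (u, v) \<in> \<rho>"
    if "u \<in> words X" "v \<in> words X" for u v
    unfolding cls cong Q \<rho>_def using that by (intro W.quot_quot_class_eq_iff T) simp_all
  have hom: "Inv_class X ?T \<in> hom (word_monoid X) (Inv X ?T)"
    unfolding cls Inv_def cong Q by (rule W.quot_quot_class_hom)
  have surj: "Inv_class X ?T ` words X = carrier (Inv X ?T)"
    unfolding cls Inv_def cong Q using W.quot_quot_class_surj by simp

  text \<open>Deleting the letters outside of \<open>X\<close> extends the congruence to all words, so that Wagner's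
    relations hold without side conditions.\<close>

  interpret presented_words G X \<iota> "w ` I" "\<lambda>u v. (?F u, ?F v) \<in> \<rho>"
  proof unfold_locales
    show "(?F u, ?F u) \<in> \<rho>" for u
      by (auto simp: \<rho>_def intro: cong_gen.refl)
    show "(?F v, ?F u) \<in> \<rho>" if "(?F u, ?F v) \<in> \<rho>" for u v
      using that unfolding \<rho>_def by (rule cong_gen.sym)
    show "(?F u, ?F k) \<in> \<rho>" if "(?F u, ?F v) \<in> \<rho>" "(?F v, ?F k) \<in> \<rho>" for u v k
      using that unfolding \<rho>_def by (rule cong_gen.trans)
    show "(?F (u @ v), ?F (u' @ v')) \<in> \<rho>" if "(?F u, ?F u') \<in> \<rho>" "(?F v, ?F v') \<in> \<rho>" for u u' v v'
      using cong_gen.mult[OF that[unfolded \<rho>_def]] by (simp add: \<rho>_def)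
    show "(?F (u @ winv u @ u), ?F u) \<in> \<rho>" for u
    proof -
      have "(?F (u @ winv u @ u), ?F u) \<in> ?S"
        unfolding filter_append filter_letters_winv using filter_letters_words[of X u] by blast
      then show ?thesis
        unfolding \<rho>_def by (intro cong_gen.base UnI1[where B = ?T]) simp_all
    qed
    show "(?F (u @ winv u @ v @ winv v), ?F (v @ winv v @ u @ winv u)) \<in> \<rho>" for u v
    proof -
      have "(?F (u @ winv u @ v @ winv v), ?F (v @ winv v @ u @ winv u)) \<in> ?S"
        unfolding filter_append filter_letters_winv
        using filter_letters_words[of X u] filter_letters_words[of X v] by blast
      then show ?thesis
        unfolding \<rho>_def by (intro cong_gen.base UnI1[where B = ?T]) simp_all
    qed
    show "(?F u, ?F (winv v)) \<in> \<rho>"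
      if "r \<in> w ` I" "cyclic_conjugate (u @ v) r" "u \<noteq> []" "v \<noteq> []" for r u v
    proof -
      have "r \<in> words X" using that(1) by (rule relators)
      then have "u \<in> words X" "v \<in> words X"
        using that(2) unfolding cyclic_conjugate_def by (metis words_append)+
      then show ?thesis
        using that unfolding \<rho>_def
        by (intro cong_gen.base) (auto simp: filter_letters_id filter_letters_winv)
    qed
  qed

  \<comment> \<open>One inclusion of kernels, checked on the generating pairs of
    \<open>\<rho>\<close>; the other one is \<open>eqv_of_xi\<close>.\<close>
  have "MsF_val u = MsF_val v" if "(u, v) \<in> \<rho>" for u v
    using that unfolding \<rho>_def
  proof induction
    case (base a b)
    from base(1) show ?case
    proof
      assume "(a, b) \<in> ?S"
      then have "MM_val a = MM_val b"
        using MM_val_regular MM_val_commute by auto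
      then show ?thesis by (simp add: MsF_val_def)
    next
      assume "(a, b) \<in> ?T"
      then obtain u v i where "a = u" "b = winv v" "u \<noteq> []" "v \<noteq> []" "i \<in> I"
        "cyclic_conjugate (u @ v) (w i)" by blast
      then have "(MM_val a, MM_val b) \<in> xi X G \<iota>"
        using relation_xi[OF assms(3)] by blast
      then show ?thesis using base by (simp add: MsF_val_eq_iff)
    qed
  next
    case (mult a b c d)
    then have "a \<in> words X" "b \<in> words X" "c \<in> words X" "d \<in> words X"
      using W.cong_gen_carrier by fastforce+
    then show ?case
      using mult.IH hom_mult[OF MsF_val_hom, of a c] hom_mult[OF MsF_val_hom, of b d] by simp
  qed simp_all
  then have ker: "(u, v) \<in> \<rho> \<longleftrightarrow> MsF_val u = MsF_val v" if "u \<in> words X" "v \<in> words X" for u v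
    using eqv_of_xi[OF that] that by (metis MsF_val_eq_iff filter_letters_id)

  have "generated_inverse_monoid X (MsF X G \<iota>) (MsF_gen X G \<iota>)"
  proof (rule generated_inverse_monoid_of_words)
    show "monoid (MsF X G \<iota>)"
      unfolding MsF_def xi_def by (rule MM.monoid_quot)
    show "MsF_val [] = \<one>\<^bsub>MsF X G \<iota>\<^esub>"
      unfolding MsF_def MsF_val_def xi_def MM.quot_one MM_val_Nil ..
    show "MsF_val u = MsF_val v \<longleftrightarrow> (?F u, ?F v) \<in> \<rho>" if "u \<in> words X" "v \<in> words X" for u v
      using ker that by (simp add: filter_letters_id)
  qed (fact MsF_val_hom MsF_val_surj MsF_gen_eq)+
  moreover have "\<exists>\<phi>\<in>iso (Inv X ?T) (MsF X G \<iota>). \<forall>u\<in>carrier (word_monoid X). \<phi> (Inv_class X ?T u) = MsF_val u"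
    using hom surj MsF_val_hom MsF_val_surj cls_eq ker
    by (intro iso_of_equal_kernels W.monoid_axioms) simp_all
  then obtain \<phi> where \<phi>: "\<phi> \<in> iso (Inv X ?T) (MsF X G \<iota>)"
    "\<And>u. u \<in> words X \<Longrightarrow> \<phi> (Inv_class X ?T u) = MsF_val u"
    by auto
  have "\<forall>x\<in>X. \<phi> (Inv_class X ?T [(x, True)]) = MsF_gen X G \<iota> x"
    using \<phi>(2) by (simp add: MsF_gen_eq letters_def)
  ultimately show ?thesis
    unfolding inverse_monoid_presented_by_def using \<phi>(1) T by auto
qed

end
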